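(* Let $\lambda>0$, $\lambda\neq1$, and let $\mu_\lambda$ be a standard probability measure on $\mathbb{R}$ which is symmetric (invariant under $x\mapsto-x$, equivalently $\alpha_n^\lambda=0$ for all $n$) and has infinite support. The following are equivalent. (A) There are a region $S$ and functions $u_\lambda,f_\lambda$ such that $\mu_\lambda$ has a generating function of ultraspherical type with parameter $\lambda$ on $S$ with functions $u_\lambda,f_\lambda$, the interchange condition on $S$ holds, and $f_\lambda(z)-\frac{(\lambda+1)\omega_2^\lambda z+\alpha_1^\lambda}{2}=\frac{E_\lambda(z)}{z}$ on $S$ for some polynomial $E_\lambda$ (notions defined in the context). (B) Either (i) $P_n^\lambda(x)=\left(\sqrt{2(1+\lambda)}\right)^nC_n^{\lambda}\!\left(\frac{x}{\sqrt{2(1+\lambda)}}\right)$ for all $n\ge0$, i.e. $\mu_\lambda$ has density proportional to $\left(1-\frac{x^2}{2(1+\lambda)}\right)^{\lambda-1/2}$ on $[-\sqrt{2(1+\lambda)},\sqrt{2(1+\lambda)}]$; or (ii) $\lambda>1/2$ and $P_n^\lambda(x)=\left(\sqrt{2\lambda}\right)^nC_n^{\lambda-1}\!\left(\frac{x}{\sqrt{2\lambda}}\right)$ for all $n\ge0$, i.e. $\mu_\lambda$ has density proportional to $\left(1-\frac{x^2}{2\lambda}\right)^{\lambda-3/2}$ on $[-\sqrt{2\lambda},\sqrt{2\lambda}]$.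
   Context: Standard measure: $\mu_\lambda$ is a probability measure on $\mathbb{R}$ with finite moments of all orders, mean $0$ and variance $1$. Its monic orthogonal polynomials $(P_n^\lambda)_{n\ge0}$ (with $\deg P_n^\lambda=n$, $\int P_n^\lambda P_m^\lambda\,d\mu_\lambda=0$ for $n\ne m$) satisfy $xP_n^\lambda(x)=P_{n+1}^\lambda(x)+\alpha_n^\lambda P_n^\lambda(x)+\omega_n^\lambda P_{n-1}^\lambda(x)$ for $n\ge0$, with $P_{-1}^\lambda:=0$, $P_0^\lambda=1$; the reals $\alpha_n^\lambda$, $\omega_n^\lambda\ge0$ are the Jacobi-Szegő parameters. Standardness means $\alpha_0^\lambda=0$, $\omega_1^\lambda=1$. Notation: $(\lambda)_n=\lambda(\lambda+1)\cdots(\lambda+n-1)$, $(\lambda)_0=1$. Complex powers $w^\lambda$ use the principal logarithm. For $\nu>-1/2$, $C_n^\nu$ denotes the monic Gegenbauer (ultraspherical) polynomial of degree $n$, i.e. the monic orthogonal polynomials for the weight $(1-x^2)^{\nu-1/2}$ on $[-1,1]$. Generating function of ultraspherical type with parameter $\lambda>0$: there are a nonempty connected open set (region) $S\subset\mathbb{C}\setminus(-\infty,0]$ with $0$ in its closure, and analytic functions $u_\lambda,f_\lambda$ on $S$, with $u_\lambda$ nowhere zero, such that $\Im f_\lambda(z)\neq0$ for $z\in S$, $\lim_{z\to0,z\in S}zf_\lambda(z)=1$, $\lim_{z\to0,z\in S}u_\lambda(z)/z^\lambda=1$, and for all $x\in\mathrm{supp}(\mu_\lambda)$ and $z\in S$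 the series below converges and $$\psi_\lambda(z,x):=\sum_{n\ge0}\frac{(\lambda)_n}{n!}P_n^\lambda(x)z^n=\frac{1}{u_\lambda(z)(f_\lambda(z)-x)^\lambda}.$$ Interchange condition on $S$: for $i\in\{0,1,2\}$ and all $z\in S$, $$\int\sum_{n\ge0}\frac{(\lambda)_n}{n!}x^iP_n^\lambda(x)z^n\,\mu_\lambda(dx)=\sum_{n\ge0}\frac{(\lambda)_n}{n!}\left(\int x^iP_n^\lambda(x)\,\mu_\lambda(dx)\right)z^n.$$ *)

theory Defs
  imports
    "HOL-Probability.Probability"
    "HOL-Complex_Analysis.Complex_Analysis"
    "HOL-Computational_Algebra.Polynomial"
begin

definition measure_supp :: "real measure \<Rightarrow> real set" where
  "measure_supp M = {x. \<forall>U. open U \<and> x \<in> U \<longrightarrow> emeasure M U > 0}"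

definition standard_measure :: "real measure \<Rightarrow> bool" where
  "standard_measure M \<longleftrightarrow>
     prob_space M \<and> sets M = sets borel \<and>
     (\<forall>n::nat. integrable M (\<lambda>x. x ^ n)) \<and>
     (\<integral>x. x \<partial>M) = 0 \<and> (\<integral>x. x\<^sup>2 \<partial>M) = 1"

definition symmetric_measure :: "real measure \<Rightarrow> bool" where
  "symmetric_measure M \<longleftrightarrow> distr M borel uminus = M"

text \<open>Used only for measures with finite moments of all orders, so that the integrals exist.\<close>

definition monic_orthogonal :: "real measure \<Rightarrow> (nat \<Rightarrow> real poly) \<Rightarrow> bool" where
  "monic_orthogonal M P \<longleftrightarrow>
     (\<forall>n. degree (P n) = n \<and> lead_coeff (P n) = 1) \<and>
     (\<forall>n m. n \<noteq> m \<longrightarrow> (\<integral>x. poly (P n) x * poly (P m) x \<partial>M) = 0)"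

text \<open>The value \<open>\<omega> 0\<close> is irrelevant, since it would multiply \<open>P\<close> at index \<open>-1\<close>, which is \<open>0\<close>.\<close>

definition jacobi_szego ::
    "(nat \<Rightarrow> real poly) \<Rightarrow> (nat \<Rightarrow> real) \<Rightarrow> (nat \<Rightarrow> real) \<Rightarrow> bool" where
  "jacobi_szego P \<alpha> \<omega> \<longleftrightarrow>
     (\<forall>n. [:0, 1:] * P n =
        P (Suc n) + smult (\<alpha> n) (P n) + (if n = 0 then 0 else smult (\<omega> n) (P (n - 1))))"

definition gegenbauer_measure :: "real \<Rightarrow> real measure" where
  "gegenbauer_measure \<nu> =
     density lborel (\<lambda>x. ennreal ((1 - x\<^sup>2) powr (\<nu> - 1/2) * indicator {-1..1} x))"

text \<open>Meaningful for \<open>\<nu> > -1/2\<close>, where the weight is integrable and the sequence is unique.\<close>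

definition gegenbauer :: "real \<Rightarrow> nat \<Rightarrow> real poly" where
  "gegenbauer \<nu> = (THE C. monic_orthogonal (gegenbauer_measure \<nu>) C)"

definition ultraspherical_gf ::
    "real measure \<Rightarrow> (nat \<Rightarrow> real poly) \<Rightarrow> real \<Rightarrow> complex set \<Rightarrow>
     (complex \<Rightarrow> complex) \<Rightarrow> (complex \<Rightarrow> complex) \<Rightarrow> bool" where
  "ultraspherical_gf M P l S u f \<longleftrightarrow>
     open S \<and> connected S \<and> S \<noteq> {} \<and> S \<inter> \<real>\<^sub>\<le>\<^sub>0 = {} \<and> 0 \<in> closure S \<and>
     u analytic_on S \<and> f analytic_on S \<and>
     (\<forall>z\<in>S. u z \<noteq> 0) \<and> (\<forall>z\<in>S. Im (f z) \<noteq> 0) \<and>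
     ((\<lambda>z. z * f z) \<longlongrightarrow> 1) (at 0 within S) \<and>
     ((\<lambda>z. u z / z powr complex_of_real l) \<longlongrightarrow> 1) (at 0 within S) \<and>
     (\<forall>x\<in>measure_supp M. \<forall>z\<in>S.
        (\<lambda>n. complex_of_real (pochhammer l n / fact n * poly (P n) x) * z ^ n) sums
          (1 / (u z * (f z - complex_of_real x) powr complex_of_real l)))"

text \<open>The integrand on the left is required to be integrable, and the series on the right to
  converge, so that the equation never holds through the default values of the
  integral or of an infinite sum.\<close>

definition interchange_condition ::
    "real measure \<Rightarrow> (nat \<Rightarrow> real poly) \<Rightarrow> real \<Rightarrow> complex set \<Rightarrow> bool" where
  "interchange_condition M P l S \<longleftrightarrow>
     (\<forall>i\<in>{0,1,2::nat}. \<forall>z\<in>S.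
        integrable M (\<lambda>x. \<Sum>n. complex_of_real (pochhammer l n / fact n * (x ^ i * poly (P n) x)) * z ^ n) \<and>
        (\<lambda>n. complex_of_real (pochhammer l n / fact n * (\<integral>x. x ^ i * poly (P n) x \<partial>M)) * z ^ n) sums
          (\<integral>x. (\<Sum>n. complex_of_real (pochhammer l n / fact n * (x ^ i * poly (P n) x)) * z ^ n) \<partial>M))"

end

theory Submission
  imports Defs "HOL-Real_Asymp.Real_Asymp"
begin

text \<open>
  Put \<open>H z = z * f z\<close>, a polynomial with \<open>H 0 = 1\<close>. Taking logarithmic derivatives of the
  generating function at two points of the support eliminates \<open>u' / u\<close>, and the resulting identity
  extends from \<open>S\<close> to a neighbourhood of \<open>0\<close>. Hence there is a power series \<open>W\<close>, the expansion of
  \<open>z * u' / u\<close>, such that every \<open>\<psi> = \<psi> (_, x)\<close> solves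
  \<open>z \<psi>' (H - x z) + (W (H - x z) + l (z H' - H)) \<psi> = 0\<close>.
  The coefficients are polynomials in \<open>x\<close>; integrating them against \<open>1\<close> and \<open>x\<close> gives two
  equations from which \<open>W\<close> can be eliminated, leaving the Riccati equation
  \<open>(H + (l - 2 b) z\<^sup>2) (H - l z\<^sup>2) = (z\<^sup>2 + H - z H') (1 + l (b - l) z\<^sup>2)\<close> with
  \<open>b = (l + 1) * \<omega> 2 / 2\<close>. Comparing degrees gives \<open>degree H \<le> 2\<close>, so that \<open>H = 1 + a z\<^sup>2\<close>, and
  comparing coefficients leaves two possible pairs \<open>(b, a)\<close>. For either of them \<open>W\<close> is known
  and the linear differential equation determines \<open>\<psi>\<close>.

  Conversely \<open>\<Sum> (l)\<^sub>n / n! P\<^sub>n(x) z\<^sup>n = (1 - x z + a z\<^sup>2) powr (- l)\<close> for the rescaled Gegenbauer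
  polynomials of parameter \<open>l\<close>, and the same series for parameter \<open>l - 1\<close> acquires the factor
  \<open>1 - a z\<^sup>2\<close>. The polynomials determine the measure, because they determine its moments and
  the candidate density has compact support.
\<close>

section \<open>Rescaled Gegenbauer polynomials\<close>

text \<open>The Jacobi-Szego parameters of the weight \<open>(1 - x\<^sup>2 / (4 * a)) powr (\<nu> - 1/2)\<close>. At
  \<open>\<nu> = 0\<close>, \<open>n = 1\<close> the formula is \<open>0 / 0\<close> and has the junk value \<open>0\<close>; the theorem never
  needs \<open>\<nu> = 0\<close>, because \<open>l \<noteq> 1\<close>.\<close>

definition ultra_omega :: "real \<Rightarrow> real \<Rightarrow> nat \<Rightarrow> real" where
  "ultra_omega a \<nu> n =
     a * (real n * (real n + 2 * \<nu> - 1)) / ((real n + \<nu>) * (real n + \<nu> - 1))"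

fun ultra_poly :: "real \<Rightarrow> real \<Rightarrow> nat \<Rightarrow> real poly" where
  "ultra_poly a \<nu> 0 = 1"
| "ultra_poly a \<nu> (Suc 0) = [:0, 1:]"
| "ultra_poly a \<nu> (Suc (Suc n)) =
     [:0, 1:] * ultra_poly a \<nu> (Suc n) - smult (ultra_omega a \<nu> (Suc n)) (ultra_poly a \<nu> n)"

lemma denominators_nonzero:
  fixes \<nu> :: real
  assumes "\<nu> > -1/2" "\<nu> \<noteq> 0"
  shows "real n + \<nu> \<noteq> 0" "1 + real n + \<nu> \<noteq> 0" "2 + real n + \<nu> \<noteq> 0"
proof -
  have "real n = 0 \<or> real n \<ge> 1" by (cases n) auto
  then show "real n + \<nu> \<noteq> 0" "1 + real n + \<nu> \<noteq> 0" "2 + real n + \<nu> \<noteq> 0"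
    using assms by auto
qed

lemma poly_ultra_poly_rec:
  "poly (ultra_poly a \<nu> (Suc (Suc n))) x =
     x * poly (ultra_poly a \<nu> (Suc n)) x
       - ultra_omega a \<nu> (Suc n) * poly (ultra_poly a \<nu> n) x"
  by simp

lemma mult_X_ultra_poly:
  "[:0, 1:] * ultra_poly a \<nu> (Suc n) =
     ultra_poly a \<nu> (Suc (Suc n)) + smult (ultra_omega a \<nu> (Suc n)) (ultra_poly a \<nu> n)"
  by simp

lemma degree_lead_coeff_ultra_poly:
  "degree (ultra_poly a \<nu> n) = n \<and> lead_coeff (ultra_poly a \<nu> n) = 1"
proof (induction a \<nu> n rule: ultra_poly.induct)
  case (3 a \<nu> n)
  let ?p = "ultra_poly a \<nu> (Suc n)" and ?q = "ultra_poly a \<nu> n"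
  have deg: "degree ([:0, 1:] * ?p) = Suc (Suc n)"
    using 3 by (subst degree_mult_eq) auto
  moreover have q: "degree (smult (ultra_omega a \<nu> (Suc n)) ?q) < Suc (Suc n)"
    using 3 degree_smult_le[of "ultra_omega a \<nu> (Suc n)" ?q] by simp
  ultimately have d: "degree (ultra_poly a \<nu> (Suc (Suc n))) = Suc (Suc n)"
    using degree_add_eq_left[of "- smult (ultra_omega a \<nu> (Suc n)) ?q" "[:0, 1:] * ?p"]
    by simp
  have "coeff (ultra_poly a \<nu> (Suc (Suc n))) (Suc (Suc n)) = coeff ?p (Suc n)"
    using coeff_eq_0[OF q] by simp
  with d 3 show ?case by metis
qed auto

text \<open>The parameters \<open>ultra_omega\<close> are linear in \<open>a\<close>, so stretching
  the variable by \<open>s\<close> multiplies them by \<open>s^2\<close>. The factor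
  \<open>s ^ n\<close> restores the monic normalization.\<close>

lemma ultra_poly_scale:
  assumes "s > 0" "s\<^sup>2 = 4 * a"
  shows "s ^ n * poly (ultra_poly (1/4) \<nu> n) (x / s) = poly (ultra_poly a \<nu> n) x"
proof (induction a \<equiv> "1/4 :: real" \<nu> n rule: ultra_poly.induct)
  case (3 \<nu> n)
  have om: "ultra_omega a \<nu> k = s\<^sup>2 * ultra_omega (1/4) \<nu> k" for k
    using assms by (simp add: ultra_omega_def)
  have "s ^ Suc (Suc n) * poly (ultra_poly (1/4) \<nu> (Suc (Suc n))) (x / s)
     = x * (s ^ Suc n * poly (ultra_poly (1/4) \<nu> (Suc n)) (x / s))
       - s\<^sup>2 * ultra_omega (1/4) \<nu> (Suc n) * (s ^ n * poly (ultra_poly (1/4) \<nu> n) (x / s))"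
    using assms(1) unfolding poly_ultra_poly_rec by (simp add: field_simps power2_eq_square)
  then show ?case using 3 om by (simp del: power_Suc)
qed (use assms in auto)

text \<open>The coefficient identity that closes the induction for the structure relation
  \<open>ultra_poly_structure\<close>.\<close>

lemma ultra_omega_Suc_Suc:
  assumes "\<nu> > -1/2" "\<nu> \<noteq> 0"
  shows "2 * (real n + 2 + \<nu>) * ultra_omega a \<nu> (Suc (Suc n)) =
     4 * a + 2 * (real n + \<nu>) * ultra_omega a \<nu> (Suc n)"
proof -
  note nz = denominators_nonzero[OF assms, of n]
  have "(real n + \<nu>) * ultra_omega a \<nu> (Suc n) = a * ((real n + 1) * (real n + 2 * \<nu>)) / (1 + real n + \<nu>)"
    using nz by (simp add: ultra_omega_def add_ac)
  moreover have "(real n + 2 + \<nu>) * ultra_omega a \<nu> (Suc (Suc n)) =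
      a * ((real n + 2) * (real n + 1 + 2 * \<nu>)) / (1 + real n + \<nu>)"
    using nz by (simp add: ultra_omega_def add_ac)
  moreover have "2 * (a * ((real n + 2) * (real n + 1 + 2 * \<nu>)) / (1 + real n + \<nu>)) =
      4 * a + 2 * (a * ((real n + 1) * (real n + 2 * \<nu>)) / (1 + real n + \<nu>))"
    using nz(2) by (simp add: divide_simps) (simp add: algebra_simps)
  ultimately show ?thesis by (simp only: mult.assoc)
qed

text \<open>Differentiating the recurrence and inserting the relation for the two preceding indices
  leaves a single coefficient to match, which \<open>ultra_omega_Suc_Suc\<close> does. With
  \<open>4 * a = r\<close> the left-hand side is the derivative term of the Pearson identity proved
  for the weight.\<close>

lemma ultra_poly_structure:
  assumes "\<nu> > -1/2" "\<nu> \<noteq> 0"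
  shows "(4 * a - x\<^sup>2) * poly (pderiv (ultra_poly a \<nu> n)) x =
    (real n + 2 * \<nu>) * (x * poly (ultra_poly a \<nu> n) x)
      - 2 * (real n + \<nu>) * poly (ultra_poly a \<nu> (Suc n)) x"
proof (induction n rule: induct_nat_012)
  case 1
  have "2 * (1 + \<nu>) * ultra_omega a \<nu> (Suc 0) = 4 * a"
    using assms(1,2) denominators_nonzero(2)[OF assms, of 0]
    by (simp add: ultra_omega_def divide_simps)
  then show ?case by (simp add: pderiv_pCons algebra_simps power2_eq_square)
next
  case (ge2 n)
  let ?y = "\<lambda>k. poly (ultra_poly a \<nu> k) x" and ?w = "ultra_omega a \<nu>"
  have d: "poly (pderiv (ultra_poly a \<nu> (Suc (Suc n)))) x =
     ?y (Suc n) + x * poly (pderiv (ultra_poly a \<nu> (Suc n))) x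
       - ?w (Suc n) * poly (pderiv (ultra_poly a \<nu> n)) x"
    by (simp add: pderiv_diff pderiv_mult pderiv_smult pderiv_pCons)
  have r2: "?w (Suc n) * ?y n = x * ?y (Suc n) - ?y (Suc (Suc n))"
    by simp
  have r3: "?y (Suc (Suc (Suc n))) = x * ?y (Suc (Suc n)) - ?w (Suc (Suc n)) * ?y (Suc n)"
    by (rule poly_ultra_poly_rec)
  have "(4 * a - x\<^sup>2) * poly (pderiv (ultra_poly a \<nu> (Suc (Suc n)))) x =
     (4 * a - x\<^sup>2) * ?y (Suc n) + x * ((4 * a - x\<^sup>2) * poly (pderiv (ultra_poly a \<nu> (Suc n))) x)
       - ?w (Suc n) * ((4 * a - x\<^sup>2) * poly (pderiv (ultra_poly a \<nu> n)) x)"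
    unfolding d by (simp only: algebra_simps)
  also have "\<dots> = (4 * a - x\<^sup>2) * ?y (Suc n)
      + x * ((real n + 1 + 2 * \<nu>) * (x * ?y (Suc n)) - 2 * (real n + 1 + \<nu>) * ?y (Suc (Suc n)))
      - ((real n + 2 * \<nu>) * x * (?w (Suc n) * ?y n) - 2 * (real n + \<nu>) * ?w (Suc n) * ?y (Suc n))"
    unfolding ge2 by (simp add: algebra_simps del: ultra_poly.simps)
  also have "\<dots> = (4 * a + 2 * (real n + \<nu>) * ?w (Suc n)) * ?y (Suc n) - (real n + 2) * x * ?y (Suc (Suc n))"
    unfolding r2 by (simp add: algebra_simps power2_eq_square del: ultra_poly.simps)
  also have "\<dots> = (real (Suc (Suc n)) + 2 * \<nu>) * (x * ?y (Suc (Suc n)))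
      - 2 * (real (Suc (Suc n)) + \<nu>) * ?y (Suc (Suc (Suc n)))"
    unfolding r3 ultra_omega_Suc_Suc[OF assms, symmetric]
    by (simp add: algebra_simps del: ultra_poly.simps)
  finally show ?case .
qed (simp_all add: pderiv_pCons)

text \<open>The n-th Taylor coefficient of (1 - t) powr (-l).\<close>

definition ultra_coeff :: "real \<Rightarrow> nat \<Rightarrow> real" where
  "ultra_coeff l n = pochhammer l n / fact n"

lemma ultra_coeff_0 [simp]: "ultra_coeff l 0 = 1"
  by (simp add: ultra_coeff_def)

lemma ultra_coeff_Suc: "real (Suc n) * ultra_coeff l (Suc n) = (l + real n) * ultra_coeff l n"
  by (simp add: ultra_coeff_def pochhammer_Suc field_simps del: of_nat_Suc)

text \<open>In this normalization the denominators of \<open>ultra_omega\<close> cancel and the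
  recurrence has coefficients linear in \<open>n\<close>. That linearity makes it a first-order
  differential equation for the generating function.\<close>

lemma ultra_coeff_ultra_poly_rec:
  assumes "l > 0"
  shows "real (n + 2) * (ultra_coeff l (Suc (Suc n)) * poly (ultra_poly a l (Suc (Suc n))) x)
    = x * (real n + 1 + l) * (ultra_coeff l (Suc n) * poly (ultra_poly a l (Suc n)) x)
      - a * (real n + 2 * l) * (ultra_coeff l n * poly (ultra_poly a l n) x)"
proof -
  have e2: "real (n + 2) * ultra_coeff l (Suc (Suc n)) = (l + real (Suc n)) * ultra_coeff l (Suc n)"
    using ultra_coeff_Suc[of "Suc n" l] by (simp add: algebra_simps)
  have e1: "ultra_coeff l (Suc n) = (l + real n) * ultra_coeff l n / real (Suc n)"
    using ultra_coeff_Suc[of n l] by (simp add: field_simps del: of_nat_Suc)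
  have w: "(l + real (Suc n)) * ultra_coeff l (Suc n) * ultra_omega a l (Suc n)
     = a * (real n + 2 * l) * ultra_coeff l n"
    unfolding e1 using assms by (simp add: ultra_omega_def divide_simps) (simp add: algebra_simps)
  have "real (n + 2) * (ultra_coeff l (Suc (Suc n)) * poly (ultra_poly a l (Suc (Suc n))) x)
    = (l + real (Suc n)) * ultra_coeff l (Suc n) *
       (x * poly (ultra_poly a l (Suc n)) x - ultra_omega a l (Suc n) * poly (ultra_poly a l n) x)"
    unfolding poly_ultra_poly_rec mult.assoc[symmetric] e2 ..
  also have "\<dots> = x * (real n + 1 + l) * (ultra_coeff l (Suc n) * poly (ultra_poly a l (Suc n)) x)
      - (l + real (Suc n)) * ultra_coeff l (Suc n) * ultra_omega a l (Suc n) * poly (ultra_poly a l n) x"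
    by (simp add: algebra_simps)
  finally show ?thesis unfolding w by simp
qed

text \<open>The monic form of \<open>C\<^sub>n\<^sup>l - C\<^sub>n\<^sub>-\<^sub>2\<^sup>l = (n + l - 1) / (l - 1) C\<^sub>n\<^sup>l\<^sup>-\<^sup>1\<close>.\<close>

lemma ultra_poly_shift_parameter:
  assumes "l > 1/2" "l \<noteq> 1"
  shows "poly (ultra_poly a (l - 1) (Suc (Suc n))) x = poly (ultra_poly a l (Suc (Suc n))) x
     - a * ((real n + 1) * (real n + 2)) / ((l + real n + 1) * (l + real n)) * poly (ultra_poly a l n) x"
proof (induction n rule: induct_nat_012)
  case 0
  have "ultra_omega a (l - 1) (Suc 0) = ultra_omega a l (Suc 0) + 2 * a / ((l + 1) * l)"
    using assms by (simp add: ultra_omega_def divide_simps) (simp add: algebra_simps)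
  then show ?case by (simp add: algebra_simps)
next
  case 1
  let ?w = "ultra_omega a l" and ?v = "ultra_omega a (l - 1)"
  have "?v (Suc 0) + ?v (Suc (Suc 0)) = ?w (Suc 0) + ?w (Suc (Suc 0)) + 6 * a / ((l + 2) * (l + 1))"
    using assms by (simp add: ultra_omega_def divide_simps) (simp add: algebra_simps)
  then show ?case by (simp add: algebra_simps)
next
  case (ge2 n)
  let ?p = "\<lambda>k. poly (ultra_poly a (l - 1) k) x" and ?q = "\<lambda>k. poly (ultra_poly a l k) x"
  let ?w = "ultra_omega a l" and ?v = "ultra_omega a (l - 1)"
  \<comment> \<open>The correction coefficient at index k. Substituting the induction hypothesis
    into the recurrence with parameter \<open>l - 1\<close> works if two identities hold: one for
    the polynomial of index n + 2 and one for that of index n.\<close>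
  define e where "e k = a * ((real k + 1) * (real k + 2)) / ((l + real k + 1) * (l + real k))" for k
  have "e (Suc (Suc n)) - e (Suc n) + ?w (Suc (Suc (Suc n))) = ?v (Suc (Suc (Suc n)))"
  proof -
    \<comment> \<open>In terms of t = l + n every denominator is a product of shifts of t, all of
      them positive.\<close>
    define t where "t = l + real n"
    have l: "l = t - real n" by (simp add: t_def)
    have "t > 0" using assms by (simp add: t_def)
    then have eqs: "e (Suc (Suc n)) = a * ((real n + 3) * (real n + 4)) / ((t + 3) * (t + 2))"
      "e (Suc n) = a * ((real n + 2) * (real n + 3)) / ((t + 2) * (t + 1))"
      "?w (Suc (Suc (Suc n))) = a * ((real n + 3) * (2 * t - real n + 2)) / ((t + 3) * (t + 2))"
      "?v (Suc (Suc (Suc n))) = a * ((real n + 3) * (2 * t - real n)) / ((t + 2) * (t + 1))"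
      by (simp_all add: e_def ultra_omega_def l algebra_simps)
    show ?thesis unfolding eqs using \<open>t > 0\<close>
      by (simp add: divide_simps) (simp add: algebra_simps)
  qed
  then have E1: "?v (Suc (Suc (Suc n))) = e (Suc (Suc n)) - e (Suc n) + ?w (Suc (Suc (Suc n)))" by simp
  have E2: "e (Suc n) * ?w (Suc n) = ?v (Suc (Suc (Suc n))) * e n"
  proof -
    define t where "t = l + real n"
    have l: "l = t - real n" by (simp add: t_def)
    have "t > 0" using assms by (simp add: t_def)
    then have eqs: "e n = a * ((real n + 1) * (real n + 2)) / ((t + 1) * t)"
      "e (Suc n) = a * ((real n + 2) * (real n + 3)) / ((t + 2) * (t + 1))"
      "?w (Suc n) = a * ((real n + 1) * (2 * t - real n)) / ((t + 1) * t)"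
      "?v (Suc (Suc (Suc n))) = a * ((real n + 3) * (2 * t - real n)) / ((t + 2) * (t + 1))"
      by (simp_all add: e_def ultra_omega_def l algebra_simps)
    show ?thesis unfolding eqs by simp
  qed
  have "?p (Suc (Suc (Suc (Suc n)))) = x * ?p (Suc (Suc (Suc n))) - ?v (Suc (Suc (Suc n))) * ?p (Suc (Suc n))"
    by (rule poly_ultra_poly_rec)
  also have "\<dots> = x * (?q (Suc (Suc (Suc n))) - e (Suc n) * ?q (Suc n))
      - ?v (Suc (Suc (Suc n))) * (?q (Suc (Suc n)) - e n * ?q n)"
    unfolding ge2 e_def ..
  also have "\<dots> = x * ?q (Suc (Suc (Suc n))) - e (Suc n) * (x * ?q (Suc n))
      - ?v (Suc (Suc (Suc n))) * ?q (Suc (Suc n)) + e (Suc n) * ?w (Suc n) * ?q n"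
    unfolding E2 by (simp add: algebra_simps del: ultra_poly.simps)
  also have "x * ?q (Suc n) = ?q (Suc (Suc n)) + ?w (Suc n) * ?q n"
    by simp
  also have "x * ?q (Suc (Suc (Suc n))) = ?q (Suc (Suc (Suc (Suc n)))) + ?w (Suc (Suc (Suc n))) * ?q (Suc (Suc n))"
    by (simp add: poly_ultra_poly_rec del: ultra_poly.simps)
  finally show ?case unfolding E1 e_def[of "Suc (Suc n)", symmetric]
    by (simp add: algebra_simps del: ultra_poly.simps)
qed

section \<open>The generating function as a formal power series\<close>

text \<open>Kept formal in z for fixed x, so that identities can be compared coefficientwise;
  convergence is treated separately.\<close>

definition gf_fps :: "real \<Rightarrow> (nat \<Rightarrow> real poly) \<Rightarrow> real \<Rightarrow> complex fps" where
  "gf_fps l P x = Abs_fps (\<lambda>n. complex_of_real (ultra_coeff l n * poly (P n) x))"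

text \<open>This is the logarithmic derivative of (H - x z) powr (-l) with H = 1 + a z^2. The
  coefficient of z^n for n at least 1 is the recurrence \<open>ultra_coeff_ultra_poly_rec\<close> at
  n - 1. At n = 0 and n = 1 some shifted terms vanish, hence the case distinction.\<close>

lemma gf_fps_ultra_poly_ode:
  fixes l a x :: real
  assumes "l > 0"
  defines "H \<equiv> 1 + fps_const (complex_of_real a) * fps_X ^ 2"
  defines "\<theta> \<equiv> gf_fps l (ultra_poly a l) x"
  shows "(H - fps_const (of_real x) * fps_X) * fps_deriv \<theta>
    = fps_const (of_real l) * (fps_const (of_real x) - fps_deriv H) * \<theta>"
proof -
  define c where "c n = complex_of_real (ultra_coeff l n * poly (ultra_poly a l n) x)" for n
  have nth: "fps_nth \<theta> n = c n" for n
    by (simp add: \<theta>_def gf_fps_def c_def)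
  have c1: "c (Suc 0) = of_real l * of_real x * c 0"
    using ultra_coeff_Suc[of 0 l] by (simp add: c_def)
  have c2: "of_nat (n + 2) * c (Suc (Suc n)) = of_real x * (of_nat n + 1 + of_real l) * c (Suc n)
      - of_real a * (of_nat n + 2 * of_real l) * c n" for n
    using arg_cong[OF ultra_coeff_ultra_poly_rec[OF assms(1), of n a x], of complex_of_real]
    by (simp add: c_def del: ultra_poly.simps)
  have H': "fps_deriv H = fps_const (2 * of_real a) * fps_X"
    by (simp add: H_def fps_deriv_power numeral_fps_const mult_ac)
  have "fps_deriv \<theta> + fps_const (of_real a) * (fps_X ^ 2 * fps_deriv \<theta>)
        - fps_const (of_real x) * (fps_X * fps_deriv \<theta>)
    = fps_const (of_real l * of_real x) * \<theta> - fps_const (2 * of_real l * of_real a) * (fps_X * \<theta>)"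
    (is "?L = ?R")
  proof (rule fps_ext)
    fix n
    consider "n = 0" | "n = 1" | m where "n = Suc (Suc m)"
      by (metis One_nat_def not0_implies_Suc)
    then show "fps_nth ?L n = fps_nth ?R n"
    proof cases
      case 1 then show ?thesis using c1 by (simp add: nth fps_X_power_mult_nth)
    next
      case 2 then show ?thesis using c1 c2[of 0]
        by (simp add: nth fps_X_power_mult_nth) (simp add: algebra_simps)
    next
      case (3 m) then show ?thesis using c2[of "Suc m"]
        by (simp add: nth fps_X_power_mult_nth) (simp add: algebra_simps)
    qed
  qed
  then show ?thesis unfolding H' unfolding H_def
    by (simp add: algebra_simps flip: fps_const_mult)
qed

text \<open>The quotient of \<open>ultra_coeff l (m + 2)\<close> by \<open>ultra_coeff l m\<close>
  is (l + m + 1)(l + m) / ((m + 1)(m + 2)). It cancels the fraction in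
  \<open>ultra_poly_shift_parameter\<close> and leaves the constant a.\<close>

lemma gf_fps_ultra_poly_shift_parameter:
  fixes l a x :: real
  assumes "l > 1/2" "l \<noteq> 1"
  shows "gf_fps l (ultra_poly a (l - 1)) x =
    (1 - fps_const (of_real a) * fps_X ^ 2) * gf_fps l (ultra_poly a l) x"
proof (rule fps_ext)
  fix n
  consider "n = 0" | "n = 1" | m where "n = Suc (Suc m)"
    by (metis One_nat_def not0_implies_Suc)
  then show "fps_nth (gf_fps l (ultra_poly a (l - 1)) x) n =
      fps_nth ((1 - fps_const (of_real a) * fps_X ^ 2) * gf_fps l (ultra_poly a l) x) n"
  proof cases
    case (3 m)
    have "(real m + 2) * ultra_coeff l (Suc (Suc m)) = (l + real m + 1) * ultra_coeff l (Suc m)"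
      "(real m + 1) * ultra_coeff l (Suc m) = (l + real m) * ultra_coeff l m"
      using ultra_coeff_Suc[of m l] ultra_coeff_Suc[of "Suc m" l] by (simp_all add: add_ac)
    then have "(real m + 2) * (real m + 1) * ultra_coeff l (Suc (Suc m)) =
        (l + real m + 1) * (l + real m) * ultra_coeff l m"
      by (metis mult.assoc mult.commute)
    moreover have "(l + real m + 1) * (l + real m) \<noteq> 0"
      using assms by auto
    moreover have "ultra_coeff l (Suc (Suc m)) * (a * ((real m + 1) * (real m + 2)) / ((l + real m + 1) * (l + real m)))
        = a * ((real m + 2) * (real m + 1) * ultra_coeff l (Suc (Suc m))) / ((l + real m + 1) * (l + real m))"
      by (simp only: mult_ac times_divide_eq_right)
    ultimately have "ultra_coeff l (Suc (Suc m)) * (a * ((real m + 1) * (real m + 2)) / ((l + real m + 1) * (l + real m)))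
        = a * ultra_coeff l m"
      by simp
    then have "ultra_coeff l (Suc (Suc m)) * poly (ultra_poly a (l - 1) (Suc (Suc m))) x =
        ultra_coeff l (Suc (Suc m)) * poly (ultra_poly a l (Suc (Suc m))) x
         - a * (ultra_coeff l m * poly (ultra_poly a l m) x)"
      unfolding ultra_poly_shift_parameter[OF assms] right_diff_distrib mult.assoc[symmetric] by simp
    then show ?thesis using 3
      by (simp add: gf_fps_def algebra_simps fps_X_power_mult_nth del: ultra_poly.simps flip: of_real_mult of_real_diff)
  qed (simp_all add: gf_fps_def left_diff_distrib mult.assoc fps_X_power_mult_nth)
qed

section \<open>Differential equations for formal power series\<close>

text \<open>The Wronskian of the two solutions is killed by Z, so it vanishes in the integral domain
  of power series, and the quotient of the solutions is constant. Only Z nonzero is assumed because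
  the equation is applied with a Z that is divisible by z.\<close>

lemma fps_first_order_ode_unique:
  fixes \<psi> \<phi> Y Z :: "complex fps"
  assumes "Z * fps_deriv \<psi> = Y * \<psi>" "Z * fps_deriv \<phi> = Y * \<phi>" "Z \<noteq> 0"
    and "fps_nth \<psi> 0 = 1" "fps_nth \<phi> 0 = 1"
  shows "\<psi> = \<phi>"
proof -
  have inv: "\<phi> * inverse \<phi> = 1"
    using assms(5) by (simp add: inverse_mult_eq_1')
  have "Z * (fps_deriv \<psi> * \<phi> - \<psi> * fps_deriv \<phi>) = 0"
    (is "?l = 0")
  proof -
    have "?l = (Z * fps_deriv \<psi>) * \<phi> - \<psi> * (Z * fps_deriv \<phi>)"
      by (simp add: algebra_simps)
    then show ?thesis unfolding assms(1,2) by (simp add: algebra_simps)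
  qed
  then have comm: "\<psi> * fps_deriv \<phi> = fps_deriv \<psi> * \<phi>"
    using assms(3) by simp
  have "fps_deriv (\<psi> * inverse \<phi>) =
      fps_deriv \<psi> * inverse \<phi> - \<psi> * fps_deriv \<phi> * (inverse \<phi> * inverse \<phi>)"
    using assms(5) by (simp add: fps_inverse_deriv power2_eq_square algebra_simps)
  also have "\<dots> = fps_deriv \<psi> * inverse \<phi> - fps_deriv \<psi> * inverse \<phi> * (\<phi> * inverse \<phi>)"
    unfolding comm by (simp only: mult_ac)
  finally have "fps_deriv (\<psi> * inverse \<phi>) =
      fps_deriv \<psi> * inverse \<phi> - fps_deriv \<psi> * inverse \<phi> * (\<phi> * inverse \<phi>)" .
  then have "fps_deriv (\<psi> * inverse \<phi>) = 0"
    by (simp add: inv)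
  then have "\<psi> * inverse \<phi> = fps_const (fps_nth (\<psi> * inverse \<phi>) 0)"
    by (rule fps_deriv_eq_0_iff[THEN iffD1])
  also have "\<dots> = 1" using assms(4,5) by simp
  finally have "\<psi> * inverse \<phi> * \<phi> = 1 * \<phi>" by simp
  then show ?thesis using inv by (simp add: mult.assoc mult.commute[of "inverse \<phi>"])
qed

text \<open>The hypothesis on W says W = l - z V' / V. Logarithmic derivatives add, so multiplying
  \<theta> by V changes only W. Both families are covered: V = 1 for parameter l and V = 1 - a z^2
  for parameter l - 1.\<close>

lemma gf_equation_of_factor:
  fixes \<theta> V W H x l :: "complex fps"
  assumes ode: "(H - x * fps_X) * fps_deriv \<theta> = l * (x - fps_deriv H) * \<theta>"
    and W: "W * V = l * V - fps_X * fps_deriv V" and "V \<noteq> 0"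
  shows "fps_X * fps_deriv (V * \<theta>) * (H - x * fps_X)
     + (W * (H - x * fps_X) + l * (fps_X * fps_deriv H - H)) * (V * \<theta>) = 0"
proof -
  have "V * (fps_X * fps_deriv (V * \<theta>) * (H - x * fps_X)
     + (W * (H - x * fps_X) + l * (fps_X * fps_deriv H - H)) * (V * \<theta>)) =
     V * (fps_X * fps_deriv V * \<theta> * (H - x * fps_X) + fps_X * V * ((H - x * fps_X) * fps_deriv \<theta>)
       + (W * V * (H - x * fps_X) + V * l * (fps_X * fps_deriv H - H)) * \<theta>)"
    by (simp add: algebra_simps)
  also have "\<dots> = 0" unfolding ode W by (simp add: algebra_simps)
  finally show ?thesis using assms(3) by simp
qed

text \<open>If H had degree d > 2, the left-hand side would have degree 2 d and the right-hand side
  at most d + 2. For a quadratic H the coefficients of z, z^2 and z^4 determine everything.\<close>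

lemma riccati_polynomial_solution:
  fixes H :: "complex poly" and l b :: real
  assumes l: "l > 0" "l \<noteq> 1" and H0: "coeff H 0 = 1"
    and eq: "(H + smult (of_real (l - 2 * b)) (monom 1 2)) * (H - smult (of_real l) (monom 1 2)) =
      (monom 1 2 + H - [:0, 1:] * pderiv H) * (1 + smult (of_real (l * (b - l))) (monom 1 2))"
  shows "(b = (1 + l) * (1 + 2 * l) / (2 * (2 + l)) \<and> H = [:1, 0, of_real ((1 + l) / 2):]) \<or>
    (b = l - 1/2 \<and> H = [:1, 0, of_real (l / 2):])"
proof -
  have "degree H \<le> 2"
  proof (rule ccontr)
    assume "\<not> degree H \<le> 2"
    then have d: "degree H > 2" by simp
    have d': "degree (smult c (monom 1 2 :: complex poly)) \<le> 2" for c :: complex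
      by (intro degree_smult_le[THEN order_trans] degree_monom_le)
    have dp: "degree (H + smult c (monom 1 2)) = degree H" for c
      using d le_less_trans[OF d' d] by (intro degree_add_eq_left)
    have dm: "degree (H - smult c (monom 1 2)) = degree H" for c
      using dp[of "- c"] by simp
    have nz: "H + smult c (monom 1 2) \<noteq> 0" "H - smult c (monom 1 2) \<noteq> 0" for c
      using dp[of c] dm[of c] d by auto
    have "degree H + degree H = degree ((H + smult (of_real (l - 2 * b)) (monom 1 2)) * (H - smult (of_real l) (monom 1 2)))"
      by (subst degree_mult_eq) (use nz dp dm in auto)
    also have "\<dots> \<le> degree (monom 1 2 + H - [:0, 1:] * pderiv H) + degree (1 + smult (of_real (l * (b - l))) (monom 1 2 :: complex poly))"
      unfolding eq by (rule degree_mult_le)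
    also have "\<dots> \<le> degree H + 2"
    proof (intro add_mono degree_diff_le degree_add_le d')
      show "degree (monom 1 2 :: complex poly) \<le> degree H" using d degree_monom_le[of "1::complex" 2] by linarith
      show "degree ([:0, 1:] * pderiv H) \<le> degree H"
        using d degree_mult_le[of "[:0, 1:]" "pderiv H"] by (simp add: degree_pderiv)
    qed auto
    finally show False using d by simp
  qed
  define h1 h2 where "h1 = coeff H 1" and "h2 = coeff H 2"
  have H: "H = [:1, h1, h2:]"
  proof (rule poly_eqI)
    fix n
    consider "n = 0" | "n = 1" | "n = 2" | m where "n = Suc (Suc (Suc m))"
      by (metis One_nat_def Suc_1 not0_implies_Suc)
    then show "coeff H n = coeff [:1, h1, h2:] n"
      by cases (use H0 \<open>degree H \<le> 2\<close> in
        \<open>simp_all add: h1_def h2_def coeff_eq_0 numeral_2_eq_2\<close>)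
  qed
  have m: "monom 1 2 = [:0, 0, 1 :: complex:]"
    by (simp add: numeral_2_eq_2 monom_Suc)
  have A: "[:1, h1, h2 + of_real (l - 2 * b):] * [:1, h1, h2 - of_real l:] =
      [:1, 0, 1 - h2:] * [:1, 0, of_real (l * (b - l)):]"
    using eq unfolding H m by (auto simp: pderiv_pCons one_pCons algebra_simps)
  \<comment> \<open>The coefficient of z is 2 * h1 on the left and 0 on the right.\<close>
  then have h1: "h1 = 0" by (auto simp: algebra_simps)
  have c: "2 * h2 + of_real (l - 2 * b) - of_real l = 1 - h2 + of_real (l * (b - l))"
    "(h2 + of_real (l - 2 * b)) * (h2 - of_real l) = (1 - h2) * of_real (l * (b - l))"
    using A unfolding h1 by (simp_all add: algebra_simps)
  \<comment> \<open>The coefficient of z^2 is linear in \<open>h2\<close>; solving it shows that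
    \<open>h2\<close> is real.\<close>
  define h where "h = (1 + 2 * b + l * (b - l)) / 3"
  have h2: "h2 = of_real h"
    using c(1) by (simp add: h_def field_simps)
  have "complex_of_real ((h + (l - 2 * b)) * (h - l)) = of_real ((1 - h) * (l * (b - l)))"
    using c(2) unfolding h2 by simp
  then have e: "(h + (l - 2 * b)) * (h - l) = (1 - h) * (l * (b - l))"
    using of_real_eq_iff by blast
  \<comment> \<open>Inserting h into the z^4 coefficient turns it into this product, up to the
    factor -9/2. The assumption that l is not 1 enters here.\<close>
  have "(1 - l) * ((2 * (2 + l) * b - (1 + l) * (1 + 2 * l)) * (b - (l - 1/2))) = 0"
  proof -
    have "(1 - l) * ((2 * (2 + l) * b - (1 + l) * (1 + 2 * l)) * (b - (l - 1/2)))
      = - (9/2) * ((h + (l - 2 * b)) * (h - l) - (1 - h) * (l * (b - l)))"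
      unfolding h_def by (simp add: field_simps)
    with e show ?thesis by simp
  qed
  then consider "2 * (2 + l) * b = (1 + l) * (1 + 2 * l)" | "b = l - 1/2"
    using l by auto
  then show ?thesis
  proof cases
    case 1
    then have b: "b = (1 + l) * (1 + 2 * l) / (2 * (2 + l))" using l by (simp add: field_simps)
    have "h = (1 + l) / 2" unfolding h_def b using l by (simp add: divide_simps) (simp add: algebra_simps)
    with b H h2 h1 show ?thesis by simp
  next
    case 2
    have "h = l / 2" unfolding h_def 2 by (simp add: field_simps)
    with 2 H h2 h1 show ?thesis by simp
  qed
qed

section \<open>Orthogonality, uniqueness and moments\<close>

text \<open>By second countability the complement of the support is covered by countably many basic
  open sets of measure zero.\<close>

lemma AE_measure_supp:
  assumes "sets M = sets borel"
  shows "AE x in M. x \<in> measure_supp M"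
proof -
  obtain B :: "real set set" where B: "countable B" "topological_basis B"
    using ex_countable_basis by blast
  define N where "N = {b \<in> B. emeasure M b = 0}"
  have "\<Union>N \<in> null_sets M"
  proof -
    have "(\<Union>b\<in>N. b) \<in> null_sets M"
      using B topological_basis_open[OF B(2)] assms
      by (intro null_sets_UN') (auto simp: N_def null_sets_def)
    then show ?thesis by simp
  qed
  moreover have "{x \<in> space M. x \<notin> measure_supp M} \<subseteq> \<Union>N"
  proof
    fix x assume "x \<in> {x \<in> space M. x \<notin> measure_supp M}"
    then obtain U where U: "open U" "x \<in> U" "emeasure M U = 0"
      by (auto simp: measure_supp_def)
    obtain b where b: "b \<in> B" "x \<in> b" "b \<subseteq> U"
      using topological_basisE[OF B(2) U(1,2)] .
    have "emeasure M b \<le> emeasure M U"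
      using U(1) b(3) assms by (intro emeasure_mono) auto
    then show "x \<in> \<Union>N" using U b by (auto simp: N_def)
  qed
  ultimately show ?thesis by (rule AE_I')
qed

text \<open>The total mass is left free so that the unnormalized Gegenbauer weight is an
  instance.\<close>

locale real_moment_measure =
  fixes M :: "real measure"
  assumes sets_borel [measurable_cong]: "sets M = sets borel"
    and integrable_power: "\<And>n. integrable M (\<lambda>x. x ^ n)"
begin

lemma integrable_poly [simp, intro]: "integrable M (poly p)"
  unfolding poly_altdef by (intro Bochner_Integration.integrable_sum integrable_mult_right integrable_power)

lemma integrable_poly_mult [simp, intro]: "integrable M (\<lambda>x. poly p x * poly q x)"
proof -
  have "(\<lambda>x. poly p x * poly q x) = poly (p * q)" by (rule ext) simp
  then show ?thesis by simp
qed

lemma integral_poly_diff_smult: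
  "(\<integral>x. poly (p - smult c q) x \<partial>M) = (\<integral>x. poly p x \<partial>M) - c * (\<integral>x. poly q x \<partial>M)"
  using Bochner_Integration.integral_diff[OF integrable_poly[of p] integrable_poly[of "smult c q"]] by simp

text \<open>A vanishing integral makes p zero almost everywhere. The complement of the finite root
  set of a nonzero p is then an open null set, which misses the support, so the support would be
  finite.\<close>

lemma poly_eq_0_if_integral_square_eq_0:
  assumes "infinite (measure_supp M)" "(\<integral>x. poly p x * poly p x \<partial>M) = 0"
  shows "p = 0"
proof (rule ccontr)
  assume "p \<noteq> 0"
  then have fin: "finite {x. poly p x = 0}" by (rule poly_roots_finite)
  with assms(1) obtain x where x: "x \<in> measure_supp M" "poly p x \<noteq> 0"
    using finite_subset[of "measure_supp M" "{x. poly p x = 0}"] by auto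
  have op: "open (- {x. poly p x = 0})"
    using finite_imp_closed[OF fin] by auto
  have "AE x in M. poly p x * poly p x = 0"
    using assms(2) by (subst (asm) integral_nonneg_eq_0_iff_AE) auto
  then have "AE x in M. x \<notin> - {x. poly p x = 0}"
    by auto
  moreover have "- {x. poly p x = 0} \<in> sets M"
    using op sets_borel by auto
  ultimately have "emeasure M (- {x. poly p x = 0}) = 0"
    by (metis AE_iff_measurable[of "- {x. poly p x = 0}" M] AE_not_in Collect_mem_eq null_setsD1 AE_iff_null_sets)
  then show False using x op unfolding measure_supp_def by force
qed

end

text \<open>A monic sequence with one polynomial in each degree is a triangular basis: subtracting a
  multiple of P n removes the coefficient at n. The bound is put on coefficients rather than on the
  degree so that n = 0 is exactly the zero polynomial.\<close>

lemma monic_sequence_induct: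
  fixes P :: "nat \<Rightarrow> 'a :: comm_ring_1 poly"
  assumes "\<And>n. degree (P n) = n \<and> lead_coeff (P n) = 1"
    and "\<And>i. i \<ge> n \<Longrightarrow> coeff r i = 0"
    and "Q 0" and "\<And>r c k. k < n \<Longrightarrow> Q r \<Longrightarrow> Q (r + smult c (P k))"
  shows "Q r"
  using assms(2,4)
proof (induction n arbitrary: r)
  case 0
  then have "r = 0" by (simp add: poly_eq_iff)
  then show ?case using assms(3) by simp
next
  case (Suc n)
  let ?r = "r - smult (coeff r n) (P n)"
  have "Q ?r"
  proof (rule Suc.IH)
    fix i assume "i \<ge> n"
    then consider "i = n" | "i > n" by linarith
    then show "coeff ?r i = 0"
      by cases (use assms(1)[of n] Suc.prems(1)[of i] in \<open>auto simp: coeff_eq_0\<close>)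
  qed (use Suc.prems(2) in auto)
  then have "Q (?r + smult (coeff r n) (P n))"
    by (rule Suc.prems(2)[rotated]) simp
  then show ?case by simp
qed

context real_moment_measure
begin

lemma integral_poly_add_smult_mult:
  "(\<integral>x. poly (p + smult c q) x * poly t x \<partial>M) =
     (\<integral>x. poly p x * poly t x \<partial>M) + c * (\<integral>x. poly q x * poly t x \<partial>M)"
proof -
  have "(\<integral>x. poly (p + smult c q) x * poly t x \<partial>M) =
      (\<integral>x. poly p x * poly t x + c * (poly q x * poly t x) \<partial>M)"
    by (simp add: algebra_simps)
  also have "\<dots> = (\<integral>x. poly p x * poly t x \<partial>M) + (\<integral>x. c * (poly q x * poly t x) \<partial>M)"
    by (intro Bochner_Integration.integral_add integrable_mult_right integrable_poly_mult)
  finally show ?thesis by simp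
qed

lemma monic_orthogonal_lower_degree:
  assumes "monic_orthogonal M P" "\<And>i. i \<ge> n \<Longrightarrow> coeff r i = 0" "n \<le> m"
  shows "(\<integral>x. poly r x * poly (P m) x \<partial>M) = 0"
proof (rule monic_sequence_induct[where P = P and n = n and r = r])
  fix r c k assume "k < n" "(\<integral>x. poly r x * poly (P m) x \<partial>M) = 0"
  then show "(\<integral>x. poly (r + smult c (P k)) x * poly (P m) x \<partial>M) = 0"
    using assms(1,3) unfolding integral_poly_add_smult_mult monic_orthogonal_def by simp
next
  show "degree (P n) = n \<and> lead_coeff (P n) = 1" for n
    using assms(1) unfolding monic_orthogonal_def by blast
qed (use assms in auto)

text \<open>The leading terms cancel in P n - Q n, so the difference has lower degree, is orthogonal
  to P n and to Q n, and hence to itself.\<close>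

lemma monic_orthogonal_unique:
  assumes "infinite (measure_supp M)" "monic_orthogonal M P" "monic_orthogonal M Q"
  shows "P = Q"
proof (rule ext)
  fix n
  let ?D = "P n - Q n"
  have c: "coeff ?D i = 0" if "i \<ge> n" for i
  proof (cases "i = n")
    case True
    then show ?thesis using assms(2,3) unfolding monic_orthogonal_def by (metis coeff_diff diff_self)
  next
    case False
    then show ?thesis using that assms(2,3) by (simp add: monic_orthogonal_def coeff_eq_0)
  qed
  have D: "?D = P n + smult (-1) (Q n)" by simp
  have "(\<integral>x. poly ?D x * poly ?D x \<partial>M) =
      (\<integral>x. poly (P n) x * poly ?D x \<partial>M) + (-1) * (\<integral>x. poly (Q n) x * poly ?D x \<partial>M)"
    by (subst (1) D) (rule integral_poly_add_smult_mult)
  also have "\<dots> = 0"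
    using monic_orthogonal_lower_degree[OF assms(2) c order_refl]
      monic_orthogonal_lower_degree[OF assms(3) c order_refl]
    by (simp add: mult.commute)
  finally show "P n = Q n"
    using poly_eq_0_if_integral_square_eq_0[OF assms(1), of ?D] by (metis right_minus_eq)
qed

text \<open>The recurrence trades one factor x for neighbouring indices. Repeating this reduces the
  integral of x^k P n with k < n to means of polynomials of positive index.\<close>

lemma monic_orthogonalI_recurrence:
  assumes monic: "\<And>n. degree (P n) = n \<and> lead_coeff (P n) = 1"
    and rec: "\<And>n. [:0, 1:] * P (Suc n) = P (Suc (Suc n)) + smult (\<omega> (Suc n)) (P n)"
    and mean: "\<And>n. n > 0 \<Longrightarrow> (\<integral>x. poly (P n) x \<partial>M) = 0"
  shows "monic_orthogonal M P"
proof -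
  have pow: "(\<integral>x. x ^ k * poly (P n) x \<partial>M) = 0" if "k < n" for k n
    using that
  proof (induction k arbitrary: n)
    case (Suc k)
    then obtain m where n: "n = Suc m" and "k < m" by (cases n) auto
    have "(\<integral>x. x ^ Suc k * poly (P n) x \<partial>M) = (\<integral>x. x ^ k * poly ([:0, 1:] * P (Suc m)) x \<partial>M)"
      by (simp add: n algebra_simps)
    also have "\<dots> = (\<integral>x. poly (P (Suc (Suc m)) + smult (\<omega> (Suc m)) (P m)) x * poly (monom 1 k) x \<partial>M)"
      unfolding rec by (simp add: poly_monom mult.commute)
    also have "\<dots> = 0"
      unfolding integral_poly_add_smult_mult
      using Suc.IH[of "Suc (Suc m)"] Suc.IH[of m] \<open>k < m\<close>
      by (simp add: poly_monom mult.commute)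
    finally show ?case .
  qed (use mean in auto)
  have ord: "(\<integral>x. poly r x * poly (P m) x \<partial>M) = 0" if "\<And>i. i \<ge> n \<Longrightarrow> coeff r i = 0" "n \<le> m" for r n m
  proof (rule monic_sequence_induct[where P = "\<lambda>k. monom 1 k" and n = n and r = r])
    fix r c k assume "k < n" "(\<integral>x. poly r x * poly (P m) x \<partial>M) = 0"
    then show "(\<integral>x. poly (r + smult c (monom 1 k)) x * poly (P m) x \<partial>M) = 0"
      using pow[of k m] that(2) unfolding integral_poly_add_smult_mult by (simp add: poly_monom)
  qed (use that in \<open>auto simp: degree_monom_eq\<close>)
  have "(\<integral>x. poly (P n) x * poly (P m) x \<partial>M) = 0" if "n < m" for n m
    using that monic[of n] by (intro ord[of "Suc n"]) (auto simp: coeff_eq_0)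
  then show ?thesis using monic unfolding monic_orthogonal_def
    by (metis (no_types, lifting) Bochner_Integration.integral_cong linorder_neqE_nat mult.commute)
qed

end

text \<open>The two integrals are linear functionals that agree on the basis P: both vanish at
  positive index, and P 0 = 1 yields the total mass.\<close>

lemma integral_poly_eq_of_mean_zero_sequence:
  assumes "real_moment_measure M" "real_moment_measure N"
    and monic: "\<And>n. degree (P n) = n \<and> lead_coeff (P n) = 1"
    and "\<And>n. n > 0 \<Longrightarrow> (\<integral>x. poly (P n) x \<partial>M) = 0" "\<And>n. n > 0 \<Longrightarrow> (\<integral>x. poly (P n) x \<partial>N) = 0"
    and "measure M (space M) = measure N (space N)"
  shows "(\<integral>x. poly r x \<partial>M) = (\<integral>x. poly r x \<partial>N)"
proof -
  interpret M: real_moment_measure M by fact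
  interpret N: real_moment_measure N by fact
  show ?thesis
  proof (rule monic_sequence_induct[where P = P and n = "Suc (degree r)" and r = r])
    fix r c k assume step: "(\<integral>x. poly r x \<partial>M) = (\<integral>x. poly r x \<partial>N)"
    have "P 0 = 1" using monic[of 0] by (metis degree_eq_zeroE lead_coeff_pCons(2) one_pCons)
    then have "(\<integral>x. poly (P k) x \<partial>M) = (\<integral>x. poly (P k) x \<partial>N)"
      using assms(4-6) by (cases k) auto
    then show "(\<integral>x. poly (r + smult c (P k)) x \<partial>M) = (\<integral>x. poly (r + smult c (P k)) x \<partial>N)"
      using step M.integral_poly_diff_smult[of r "-c" "P k"] N.integral_poly_diff_smult[of r "-c" "P k"] by simp
  qed (rule monic, auto simp: coeff_eq_0)
qed

section \<open>Determinacy by moments\<close>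

text \<open>Both characteristic functions are close to the same Taylor polynomial. The remainders
  are controlled by the even moments, which are common to both measures and at most |B|^(2 n), so a
  bound on N alone suffices. Even orders avoid absolute moments.\<close>

lemma real_distribution_eqI_moments:
  assumes "real_distribution M" "real_distribution N"
    and int: "\<And>n. integrable M (\<lambda>x. x ^ n)" "\<And>n. integrable N (\<lambda>x. x ^ n)"
    and eq: "\<And>n. (\<integral>x. x ^ n \<partial>M) = (\<integral>x. x ^ n \<partial>N)"
    and bound: "AE x in N. \<bar>x\<bar> \<le> B"
  shows "M = N"
proof (rule Levy_uniqueness[OF assms(1,2)], rule ext)
  fix t :: real
  interpret M: real_distribution M by fact
  interpret N: real_distribution N by fact
  define S :: "nat \<Rightarrow> complex" where "S n = (\<Sum>k\<le>n. ((\<i> * t) ^ k / fact k) * complex_of_real (\<integral>x. x ^ k \<partial>N))" for n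
  define err :: "nat \<Rightarrow> real" where "err n = 2 * ((2 * \<bar>t\<bar> ^ (2 * n) / fact (2 * n)) * (\<integral>x. x ^ (2 * n) \<partial>N))" for n
  have "cmod (char M t - char N t) \<le> err n" for n
  proof -
    have "cmod (char M t - S (2 * n)) \<le> (2 * \<bar>t\<bar> ^ (2 * n) / fact (2 * n)) * (\<integral>x. x ^ (2 * n) \<partial>N)"
      using M.char_approx1[of "2 * n" t] int unfolding S_def eq[symmetric] by (simp add: power_even_abs)
    moreover have "cmod (char N t - S (2 * n)) \<le> (2 * \<bar>t\<bar> ^ (2 * n) / fact (2 * n)) * (\<integral>x. x ^ (2 * n) \<partial>N)"
      using N.char_approx1[of "2 * n" t] int unfolding S_def by (simp add: power_even_abs)
    ultimately have "cmod (char M t - S (2 * n)) + cmod (char N t - S (2 * n)) \<le> err n"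
      unfolding err_def by linarith
    then show ?thesis
      using norm_triangle_ineq4[of "char M t - S (2 * n)" "char N t - S (2 * n)"] by simp
  qed
  moreover have "err n \<le> 4 * ((\<bar>t\<bar> * \<bar>B\<bar>) ^ (2 * n) / fact (2 * n))" for n
  proof -
    have "(\<integral>x. x ^ (2 * n) \<partial>N) \<le> (\<integral>x. \<bar>B\<bar> ^ (2 * n) \<partial>N)"
    proof (rule integral_mono_AE)
      show "AE x in N. x ^ (2 * n) \<le> \<bar>B\<bar> ^ (2 * n)"
        using bound
      proof eventually_elim
        case (elim x)
        then have "\<bar>x\<bar> ^ (2 * n) \<le> \<bar>B\<bar> ^ (2 * n)" by (intro power_mono) auto
        then show ?case by (simp add: power_even_abs)
      qed
    qed (use int in auto)
    then have "(\<integral>x. x ^ (2 * n) \<partial>N) \<le> \<bar>B\<bar> ^ (2 * n)" using N.prob_space by simp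
    then have "(4 * \<bar>t\<bar> ^ (2 * n) / fact (2 * n)) * (\<integral>x. x ^ (2 * n) \<partial>N)
        \<le> (4 * \<bar>t\<bar> ^ (2 * n) / fact (2 * n)) * \<bar>B\<bar> ^ (2 * n)"
      by (intro mult_left_mono) auto
    then show ?thesis by (simp add: err_def power_mult_distrib)
  qed
  ultimately have le: "cmod (char M t - char N t) \<le> 4 * ((\<bar>t\<bar> * \<bar>B\<bar>) ^ (2 * n) / fact (2 * n))" for n
    using order_trans by blast
  have "(\<lambda>n. (\<bar>t\<bar> * \<bar>B\<bar>) ^ n / fact n) \<longlonglongrightarrow> 0"
    using summable_exp[of "\<bar>t\<bar> * \<bar>B\<bar>"] by (intro summable_LIMSEQ_zero) (simp add: divide_inverse mult.commute)
  then have "(\<lambda>n. (\<bar>t\<bar> * \<bar>B\<bar>) ^ (2 * n) / fact (2 * n)) \<longlonglongrightarrow> 0"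
    by (rule LIMSEQ_subseq_LIMSEQ[unfolded o_def]) (simp add: strict_mono_def)
  then have "(\<lambda>n. 4 * ((\<bar>t\<bar> * \<bar>B\<bar>) ^ (2 * n) / fact (2 * n))) \<longlonglongrightarrow> 4 * 0"
    by (intro tendsto_mult_left)
  then have "cmod (char M t - char N t) \<le> 4 * 0"
    by (rule LIMSEQ_le_const) (use le in auto)
  then show "char M t = char N t" by simp
qed

section \<open>The ultraspherical weight\<close>

text \<open>Here r is the squared half-width of the interval; it corresponds to a = r / 4 in
  \<open>ultra_poly\<close>.\<close>

definition ultra_weight :: "real \<Rightarrow> real \<Rightarrow> real \<Rightarrow> real \<Rightarrow> real" where
  "ultra_weight c r \<nu> x = c * (1 - x\<^sup>2 / r) powr (\<nu> - 1/2) * indicator {- sqrt r..sqrt r} x"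

definition ultra_measure :: "real \<Rightarrow> real \<Rightarrow> real \<Rightarrow> real measure" where
  "ultra_measure c r \<nu> = density lborel (\<lambda>x. ennreal (ultra_weight c r \<nu> x))"

lemma borel_measurable_ultra_weight [measurable]: "ultra_weight c r \<nu> \<in> borel_measurable borel"
  unfolding ultra_weight_def by measurable

lemma sets_ultra_measure [simp, measurable_cong]: "sets (ultra_measure c r \<nu>) = sets borel"
  by (simp add: ultra_measure_def)

lemma space_ultra_measure [simp]: "space (ultra_measure c r \<nu>) = UNIV"
  by (simp add: ultra_measure_def)

lemma ultra_weight_nonneg: "c \<ge> 0 \<Longrightarrow> ultra_weight c r \<nu> x \<ge> 0"
  by (simp add: ultra_weight_def)

text \<open>The affine substitution t = 1/2 + x / (2 sqrt r) gives 1 - x^2 / r = 4 t (1 - t), which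
  turns the weight into a multiple of the Beta integrand with both parameters \<nu> + 1/2.\<close>

lemma integrable_ultra_weight:
  assumes "r > 0" "\<nu> > -1/2"
  shows "integrable lborel (ultra_weight c r \<nu>)"
proof -
  define e s where "e = \<nu> - 1/2" and "s = sqrt r"
  have s: "s > 0" "s\<^sup>2 = r" using assms(1) by (auto simp: s_def)
  define f :: "real \<Rightarrow> real" where "f t = indicator {0..1} t * (t powr e * (1 - t) powr e)" for t
  have "integrable lborel f"
    using integrable_Beta[of "\<nu> + 1/2" "\<nu> + 1/2"] assms(2)
    by (simp add: set_integrable_def f_def[abs_def] e_def)
  then have "integrable lborel (\<lambda>x. f (1/2 + (1 / (2 * s)) * x))"
    by (rule lborel_integrable_real_affine) (use s in auto)
  then have "integrable lborel (\<lambda>x. c * 4 powr e * f (1/2 + (1 / (2 * s)) * x))"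
    by (rule integrable_mult_right)
  also have "(\<lambda>x. c * 4 powr e * f (1/2 + (1 / (2 * s)) * x)) = ultra_weight c r \<nu>"
  proof
    fix x
    let ?t = "1/2 + (1 / (2 * s)) * x"
    have iff: "?t \<in> {0..1} \<longleftrightarrow> x \<in> {- s..s}"
      using s by (auto simp: field_simps)
    have "1 - x\<^sup>2 / r = 4 * (?t * (1 - ?t))"
      using s(1) unfolding s(2)[symmetric] by (simp add: field_simps power2_eq_square)
    then show "c * 4 powr e * f ?t = ultra_weight c r \<nu> x"
      using iff by (auto simp: f_def ultra_weight_def powr_mult s_def e_def indicator_def)
  qed
  finally show ?thesis .
qed

lemma AE_ultra_measure: "AE x in ultra_measure c r \<nu>. \<bar>x\<bar> \<le> sqrt r"
  unfolding ultra_measure_def by (subst AE_density) (auto simp: ultra_weight_def indicator_def)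

lemma real_moment_measure_ultra_measure:
  assumes "c > 0" "r > 0" "\<nu> > -1/2"
  shows "real_moment_measure (ultra_measure c r \<nu>)"
proof
  fix n :: nat
  have "integrable lborel (\<lambda>x. ultra_weight c r \<nu> x * x ^ n)"
  proof (rule Bochner_Integration.integrable_bound)
    show "integrable lborel (\<lambda>x. sqrt r ^ n * ultra_weight c r \<nu> x)"
      using integrable_ultra_weight[OF assms(2,3)] by simp
    show "AE x in lborel. norm (ultra_weight c r \<nu> x * x ^ n) \<le> norm (sqrt r ^ n * ultra_weight c r \<nu> x)"
    proof (rule AE_I2)
      fix x
      show "norm (ultra_weight c r \<nu> x * x ^ n) \<le> norm (sqrt r ^ n * ultra_weight c r \<nu> x)"
      proof (cases "\<bar>x\<bar> \<le> sqrt r")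
        case True
        then have "\<bar>x\<bar> ^ n \<le> sqrt r ^ n" by (intro power_mono) auto
        then show ?thesis using assms
          by (simp add: abs_mult power_abs mult.commute mult_right_mono)
      qed (auto simp: ultra_weight_def indicator_def)
    qed
  qed measurable
  then show "integrable (ultra_measure c r \<nu>) (\<lambda>x. x ^ n)"
    unfolding ultra_measure_def using assms(1)
    by (subst integrable_density) (auto simp: ultra_weight_nonneg)
qed simp

text \<open>The weight is positive inside the interval, and a nonempty open set is not a Lebesgue
  null set.\<close>

lemma emeasure_ultra_measure_open_pos:
  assumes "c > 0" "r > 0" "open U" "x \<in> U" "x \<in> {- sqrt r<..<sqrt r}"
  shows "emeasure (ultra_measure c r \<nu>) U > 0"
proof (rule ccontr)
  assume "\<not> ?thesis"
  then have "(\<integral>\<^sup>+y. ennreal (ultra_weight c r \<nu> y) * indicator U y \<partial>lborel) = 0"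
    using assms(3) by (simp add: ultra_measure_def emeasure_density)
  then have ae: "AE y in lborel. ennreal (ultra_weight c r \<nu> y) * indicator U y = 0"
    using assms(3) by (subst (asm) nn_integral_0_iff_AE) auto
  let ?V = "U \<inter> {- sqrt r<..<sqrt r}"
  have pos: "ultra_weight c r \<nu> y > 0" if "y \<in> ?V" for y
  proof -
    have "\<bar>y\<bar> < sqrt r" using that by auto
    then have "y\<^sup>2 < r" using assms(2) by (metis real_sqrt_abs real_sqrt_less_iff)
    then show ?thesis using that assms by (simp add: ultra_weight_def)
  qed
  have "AE y in lborel. y \<notin> ?V"
    using ae by eventually_elim (use pos in \<open>force simp: indicator_def split: if_splits\<close>)
  moreover have "open ?V" using assms by auto
  ultimately have "emeasure lborel ?V = 0"
    by (subst (asm) AE_iff_measurable[where N = ?V]) auto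
  then have "?V \<in> null_sets lborel" using \<open>open ?V\<close> by (auto simp: null_sets_def)
  then have "negligible ?V"
    by (simp add: negligible_iff_null_sets null_sets_completionI)
  moreover have "?V \<noteq> {}" using assms(4,5) by blast
  ultimately show False using \<open>open ?V\<close> open_not_negligible[of ?V] by blast
qed

lemma infinite_measure_supp_ultra_measure:
  assumes "c > 0" "r > 0"
  shows "infinite (measure_supp (ultra_measure c r \<nu>))"
proof -
  have "{- sqrt r<..<sqrt r} \<subseteq> measure_supp (ultra_measure c r \<nu>)"
    using emeasure_ultra_measure_open_pos[OF assms] by (auto simp: measure_supp_def)
  moreover have "infinite {- sqrt r<..<sqrt r}"
    using assms(2) by (simp add: infinite_Ioo)
  ultimately show ?thesis using finite_subset by blast
qed

lemma measure_supp_ultra_measure_subset: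
  "measure_supp (ultra_measure c r \<nu>) \<subseteq> {- sqrt r..sqrt r}"
proof
  fix x assume x: "x \<in> measure_supp (ultra_measure c r \<nu>)"
  show "x \<in> {- sqrt r..sqrt r}"
  proof (rule ccontr)
    assume "x \<notin> {- sqrt r..sqrt r}"
    moreover have "open (- {- sqrt r..sqrt r})" by auto
    ultimately have "emeasure (ultra_measure c r \<nu>) (- {- sqrt r..sqrt r}) > 0"
      using x unfolding measure_supp_def by blast
    moreover have "emeasure (ultra_measure c r \<nu>) (- {- sqrt r..sqrt r}) = 0"
      using AE_ultra_measure[where c = c and r = r and \<nu> = \<nu>]
      by (subst (asm) AE_iff_measurable[where N = "- {- sqrt r..sqrt r}"]) (auto simp: abs_le_iff)
    ultimately show False by simp
  qed
qed

text \<open>Integrating the derivative of \<open>(1 - x\<^sup>2 / r) powr (\<nu> + 1/2) * q x\<close>, which vanishes at both ends.\<close>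

lemma integral_ultra_measure_pearson:
  fixes q :: "real poly"
  assumes "c > 0" "r > 0" "\<nu> > -1/2"
  shows "(\<integral>x. (r - x\<^sup>2) * poly (pderiv q) x - (2 * \<nu> + 1) * (x * poly q x) \<partial>ultra_measure c r \<nu>) = 0"
proof -
  define s where "s = sqrt r"
  have s: "s > 0" "s\<^sup>2 = r" using assms(2) by (auto simp: s_def)
  define p where "p = [:r, 0, -1:] * pderiv q - smult (2 * \<nu> + 1) ([:0, 1:] * q)"
  have p: "poly p x = (r - x\<^sup>2) * poly (pderiv q) x - (2 * \<nu> + 1) * (x * poly q x)" for x
    by (simp add: p_def power2_eq_square algebra_simps)
  interpret real_moment_measure "ultra_measure c r \<nu>"
    by (rule real_moment_measure_ultra_measure[OF assms])
  define F where "F x = c * r * (1 - x\<^sup>2 / r) powr (\<nu> + 1/2) * poly q x" for x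
  \<comment> \<open>F is continuous on the closed interval because \<nu> + 1/2 > 0, but for small
    \<nu> it need not be differentiable at the endpoints. Hence the interior form of the fundamental
    theorem.\<close>
  have "((\<lambda>x. ultra_weight c r \<nu> x * poly p x) has_integral F s - F (-s)) {-s..s}"
  proof (rule fundamental_theorem_of_calculus_interior)
    have "0 \<le> 1 - x\<^sup>2 / r" if "x \<in> {-s..s}" for x
    proof -
      have "x\<^sup>2 \<le> r" using that s by (auto simp: abs_le_square_iff[symmetric] simp flip: s(2))
      then show ?thesis using assms by simp
    qed
    then have "continuous_on {-s..s} (\<lambda>x. (1 - x\<^sup>2 / r) powr (\<nu> + 1/2))"
      using assms by (intro continuous_on_powr' continuous_intros) auto
    then show "continuous_on {-s..s} F"
      unfolding F_def by (intro continuous_on_mult continuous_on_const continuous_on_poly continuous_on_id)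
    fix x assume x: "x \<in> {-s<..<s}"
    then have "x\<^sup>2 < r" using s by (auto simp: abs_le_square_iff[symmetric] not_le[symmetric] simp flip: s(2))
    then have pos: "1 - x\<^sup>2 / r > 0" using assms by simp
    define b where "b = 1 - x\<^sup>2 / r"
    have d: "(F has_real_derivative c * r * ((\<nu> + 1/2) * b powr (\<nu> - 1/2) * (- (2 * x) / r)) * poly q x
        + c * r * b powr (\<nu> + 1/2) * poly (pderiv q) x) (at x)"
      unfolding F_def b_def using pos assms
      by (auto intro!: derivative_eq_intros)
    have bp: "b powr (\<nu> + 1/2) = b powr (\<nu> - 1/2) * b"
      using pos powr_add[of b "\<nu> - 1/2" 1] by (simp add: b_def add.commute)
    have "r - x\<^sup>2 = r * b" using assms by (simp add: b_def field_simps)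
    then have p': "poly p x = r * b * poly (pderiv q) x - (2 * \<nu> + 1) * (x * poly q x)"
      by (simp only: p)
    have "c * r * ((\<nu> + 1/2) * b powr (\<nu> - 1/2) * (- (2 * x) / r)) * poly q x
        + c * r * b powr (\<nu> + 1/2) * poly (pderiv q) x = c * b powr (\<nu> - 1/2) * poly p x"
      unfolding bp p' using assms by (simp add: algebra_simps)
    also have "\<dots> = ultra_weight c r \<nu> x * poly p x"
      using x by (simp add: ultra_weight_def b_def s_def)
    finally show "(F has_vector_derivative ultra_weight c r \<nu> x * poly p x) (at x)"
      using d by (simp add: has_real_derivative_iff_has_vector_derivative)
  qed (use s in auto)
  moreover have "F s = 0" "F (-s) = 0"
    using s assms by (auto simp: F_def)
  ultimately have "((\<lambda>x. ultra_weight c r \<nu> x * poly p x) has_integral 0) {-s..s}"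
    by simp
  then have "((\<lambda>x. if x \<in> {-s..s} then ultra_weight c r \<nu> x * poly p x else 0) has_integral 0) UNIV"
    by (simp only: has_integral_restrict_UNIV)
  also have "(\<lambda>x. if x \<in> {-s..s} then ultra_weight c r \<nu> x * poly p x else 0)
      = (\<lambda>x. ultra_weight c r \<nu> x * poly p x)"
    by (auto simp: ultra_weight_def s_def fun_eq_iff)
  finally have hk: "((\<lambda>x. ultra_weight c r \<nu> x * poly p x) has_integral 0) UNIV" .
  have m: "poly p \<in> borel_measurable lborel"
    unfolding poly_altdef by measurable
  have "integrable lborel (\<lambda>x. ultra_weight c r \<nu> x * poly p x)"
    using integrable_poly[of p] assms(1) m unfolding ultra_measure_def
    by (subst (asm) integrable_density) (auto simp: ultra_weight_nonneg)
  from has_integral_unique[OF has_integral_integral_lborel[OF this] hk]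
  have "(\<integral>x. poly p x \<partial>ultra_measure c r \<nu>) = 0"
    unfolding ultra_measure_def using assms(1) m
    by (subst integral_density) (auto simp: ultra_weight_nonneg)
  then show ?thesis by (simp only: p)
qed

text \<open>The structure relation turns the Pearson identity for y n into a relation between the
  integrals of x y n and y (n + 1). The three-term recurrence makes it a two-step recursion for the
  means, whose leading factor is positive because \<nu> > -1/2.\<close>

lemma integral_ultra_poly_eq_0:
  assumes "c > 0" "r > 0" "\<nu> > -1/2" "\<nu> \<noteq> 0" "n > 0"
  shows "(\<integral>x. poly (ultra_poly (r / 4) \<nu> n) x \<partial>ultra_measure c r \<nu>) = 0"
proof -
  interpret real_moment_measure "ultra_measure c r \<nu>"
    by (rule real_moment_measure_ultra_measure[OF assms(1-3)])
  let ?y = "ultra_poly (r / 4) \<nu>" and ?w = "ultra_omega (r / 4) \<nu>"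
  define L where "L p = (\<integral>x. poly p x \<partial>ultra_measure c r \<nu>)" for p :: "real poly"
  have Lm: "L (smult c p) = c * L p" for c p by (simp add: L_def)
  have Ld: "L (p - q) = L p - L q" "L (p + q) = L p + L q" for p q
    using integral_poly_diff_smult[of p 1 q] integral_poly_diff_smult[of p "-1" q] by (simp_all add: L_def)
  have step: "(real n - 1) * L ([:0, 1:] * ?y n) = 2 * (real n + \<nu>) * L (?y (Suc n))" for n
  proof -
    have "L (smult (real n - 1) ([:0, 1:] * ?y n) - smult (2 * (real n + \<nu>)) (?y (Suc n))) = 0"
    proof -
      have "poly (smult (real n - 1) ([:0, 1:] * ?y n) - smult (2 * (real n + \<nu>)) (?y (Suc n))) x =
          (r - x\<^sup>2) * poly (pderiv (?y n)) x - (2 * \<nu> + 1) * (x * poly (?y n) x)" for x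
        using ultra_poly_structure[OF assms(3,4), of "r / 4" x n] by (simp add: algebra_simps del: ultra_poly.simps)
      then show ?thesis
        using integral_ultra_measure_pearson[OF assms(1-3), of "?y n"] by (simp only: L_def)
    qed
    then show ?thesis unfolding Ld Lm by simp
  qed
  have "L (?y (Suc k)) = 0" for k
  proof (induction k rule: induct_nat_012)
    case 0
    have "(2 * \<nu> + 1) * L (?y (Suc 0)) = 0"
      using step[of 0] by (simp add: algebra_simps)
    then show ?case using assms(3) by simp
  next
    case 1
    then show ?case using step[of 1] assms(3) by simp
  next
    case (ge2 k)
    have "(real (Suc (Suc k)) - 1) * (L (?y (Suc (Suc (Suc k)))) + ?w (Suc (Suc k)) * L (?y (Suc k))) =
       2 * (real (Suc (Suc k)) + \<nu>) * L (?y (Suc (Suc (Suc k))))"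
      using step[of "Suc (Suc k)"] unfolding mult_X_ultra_poly Ld Lm .
    then have "(real k + 3 + 2 * \<nu>) * L (?y (Suc (Suc (Suc k)))) = 0"
      unfolding ge2 by (simp add: algebra_simps del: ultra_poly.simps)
    then show ?case using assms(3) by auto
  qed
  from this[of "n - 1"] assms(5) show ?thesis by (simp add: L_def)
qed

lemma monic_orthogonal_ultra_poly:
  assumes "c > 0" "r > 0" "\<nu> > -1/2" "\<nu> \<noteq> 0"
  shows "monic_orthogonal (ultra_measure c r \<nu>) (ultra_poly (r / 4) \<nu>)"
proof -
  interpret real_moment_measure "ultra_measure c r \<nu>"
    by (rule real_moment_measure_ultra_measure[OF assms(1-3)])
  show ?thesis
    using degree_lead_coeff_ultra_poly mult_X_ultra_poly integral_ultra_poly_eq_0[OF assms]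
    by (rule monic_orthogonalI_recurrence)
qed

text \<open>The definite description is resolved by uniqueness, since the weight with c = r = 1 has
  infinite support.\<close>

lemma gegenbauer_eq_ultra_poly:
  assumes "\<nu> > -1/2" "\<nu> \<noteq> 0"
  shows "gegenbauer \<nu> = ultra_poly (1/4) \<nu>"
proof -
  have g: "gegenbauer_measure \<nu> = ultra_measure 1 1 \<nu>"
    by (simp add: gegenbauer_measure_def ultra_measure_def ultra_weight_def)
  interpret real_moment_measure "ultra_measure 1 1 \<nu>"
    by (rule real_moment_measure_ultra_measure) (use assms in auto)
  have mo: "monic_orthogonal (ultra_measure 1 1 \<nu>) (ultra_poly (1/4) \<nu>)"
    using monic_orthogonal_ultra_poly[of 1 1 \<nu>] assms by simp
  show ?thesis unfolding gegenbauer_def g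
    using mo monic_orthogonal_unique[OF infinite_measure_supp_ultra_measure[of 1 1]]
    by (intro the_equality) auto
qed

lemma scaled_gegenbauer_iff:
  assumes "\<nu> > -1/2" "\<nu> \<noteq> 0" "r > 0"
  shows "(\<forall>n x. poly (P n) x = sqrt r ^ n * poly (gegenbauer \<nu> n) (x / sqrt r)) \<longleftrightarrow>
    P = ultra_poly (r / 4) \<nu>"
proof -
  have "sqrt r ^ n * poly (gegenbauer \<nu> n) (x / sqrt r) = poly (ultra_poly (r / 4) \<nu> n) x" for n x
    unfolding gegenbauer_eq_ultra_poly[OF assms(1,2)]
    by (rule ultra_poly_scale) (use assms in auto)
  then show ?thesis by (auto simp: fun_eq_iff poly_eq_poly_eq_iff[symmetric])
qed

lemma ultra_poly_iff_ultra_measure: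
  assumes \<nu>: "\<nu> > -1/2" "\<nu> \<noteq> 0" and r: "r > 0" and M: "standard_measure M" "infinite (measure_supp M)"
    and P: "monic_orthogonal M P"
  shows "P = ultra_poly (r / 4) \<nu> \<longleftrightarrow> (\<exists>c>0. M = ultra_measure c r \<nu>)"
proof
  assume "\<exists>c>0. M = ultra_measure c r \<nu>"
  then obtain c where c: "c > 0" "M = ultra_measure c r \<nu>" by blast
  interpret real_moment_measure M
    unfolding c(2) by (rule real_moment_measure_ultra_measure) (use c r \<nu> in auto)
  show "P = ultra_poly (r / 4) \<nu>"
    using monic_orthogonal_ultra_poly[of c r \<nu>] c r \<nu>
    by (intro monic_orthogonal_unique[OF M(2) P]) simp
next
  assume eq: "P = ultra_poly (r / 4) \<nu>"
  interpret M: prob_space M using M(1) by (simp add: standard_measure_def)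
  interpret real_moment_measure M
    using M(1) by unfold_locales (auto simp: standard_measure_def)
  \<comment> \<open>The mass of the weight with c = 1 is finite and positive, so its reciprocal is
    the constant that yields a probability measure.\<close>
  define I where "I = emeasure (ultra_measure 1 r \<nu>) UNIV"
  have "I = ennreal (\<integral>x. ultra_weight 1 r \<nu> x \<partial>lborel)"
    using integrable_ultra_weight[OF r \<nu>(1), of 1]
    by (simp add: I_def ultra_measure_def emeasure_density nn_integral_eq_integral ultra_weight_nonneg)
  moreover have "I > 0"
    unfolding I_def using r by (intro emeasure_ultra_measure_open_pos[of _ _ _ 0]) auto
  ultimately obtain J where J: "J > 0" "I = ennreal J"
    by (metis ennreal_less_zero_iff)
  define c where "c = 1 / J"
  have c: "c > 0" using J by (simp add: c_def)
  have "prob_space (ultra_measure c r \<nu>)"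
  proof
    have "emeasure (ultra_measure c r \<nu>) UNIV = (\<integral>\<^sup>+x. ennreal c * ennreal (ultra_weight 1 r \<nu> x) \<partial>lborel)"
      using c by (simp add: ultra_measure_def emeasure_density ultra_weight_def flip: ennreal_mult' mult.assoc)
    also have "\<dots> = ennreal c * I"
      by (subst nn_integral_cmult) (auto simp: I_def ultra_measure_def emeasure_density)
    also have "\<dots> = 1"
      using J by (simp add: c_def flip: ennreal_mult'')
    finally show "emeasure (ultra_measure c r \<nu>) (space (ultra_measure c r \<nu>)) = 1" by simp
  qed
  then interpret N: prob_space "ultra_measure c r \<nu>" .
  interpret N: real_moment_measure "ultra_measure c r \<nu>"
    by (rule real_moment_measure_ultra_measure[OF c r \<nu>(1)])
  have mean: "(\<integral>x. poly (P n) x \<partial>M) = 0" if "n > 0" for n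
  proof -
    have "(\<integral>x. poly (P n) x * poly (P 0) x \<partial>M) = 0"
      using P that by (simp add: monic_orthogonal_def)
    then show ?thesis by (simp add: eq)
  qed
  have mom: "(\<integral>x. poly q x \<partial>M) = (\<integral>x. poly q x \<partial>ultra_measure c r \<nu>)" for q
  proof (rule integral_poly_eq_of_mean_zero_sequence[of _ _ P])
    show "degree (P n) = n \<and> lead_coeff (P n) = 1" for n
      using P unfolding monic_orthogonal_def by blast
    show "(\<integral>x. poly (P n) x \<partial>ultra_measure c r \<nu>) = 0" if "n > 0" for n
      unfolding eq using c r \<nu> that by (rule integral_ultra_poly_eq_0)
    show "measure M (space M) = measure (ultra_measure c r \<nu>) (space (ultra_measure c r \<nu>))"
      using M.prob_space N.prob_space by simp
    show "(\<integral>x. poly (P n) x \<partial>M) = 0" if "n > 0" for n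
      using that by (rule mean)
  qed unfold_locales
  have "M = ultra_measure c r \<nu>"
  proof (rule real_distribution_eqI_moments)
    show "(\<integral>x. x ^ n \<partial>M) = (\<integral>x. x ^ n \<partial>ultra_measure c r \<nu>)" for n
      using mom[of "monom 1 n"] by (simp add: poly_monom)
    show "AE x in ultra_measure c r \<nu>. \<bar>x\<bar> \<le> sqrt r" by (rule AE_ultra_measure)
    show "real_distribution M" "real_distribution (ultra_measure c r \<nu>)"
      using sets_borel by unfold_locales auto
  qed (auto intro: integrable_power N.integrable_power)
  with c show "\<exists>c>0. M = ultra_measure c r \<nu>" by blast
qed

section \<open>Construction of the generating function\<close>

lemma ultra_omega_tendsto: "(\<lambda>n. ultra_omega a \<nu> n) \<longlonglongrightarrow> a"
  unfolding ultra_omega_def by real_asymp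

lemma ultra_coeff_bound:
  assumes "l > 0"
  shows "0 \<le> ultra_coeff l n \<and> ultra_coeff l n \<le> (1 + l) ^ n"
proof (induction n)
  case (Suc n)
  have eq: "ultra_coeff l (Suc n) = (l + real n) / real (Suc n) * ultra_coeff l n"
    using ultra_coeff_Suc[of n l] by (simp add: field_simps)
  have "(l + real n) / real (Suc n) \<le> 1 + l"
    using assms by (simp add: field_simps)
  then have "(l + real n) / real (Suc n) * ultra_coeff l n \<le> (1 + l) * (1 + l) ^ n"
    using Suc assms by (intro mult_mono) auto
  moreover have "0 \<le> (l + real n) / real (Suc n) * ultra_coeff l n"
    using Suc assms by (intro mult_nonneg_nonneg divide_nonneg_nonneg) auto
  ultimately show ?case unfolding eq by simp
qed simp

text \<open>The recurrence coefficients converge and are therefore bounded. The bound is uniform in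
  x on the interval, which later gives one radius of convergence and one integrable majorant for all
  x.\<close>

lemma ultra_poly_bound:
  obtains K where "K \<ge> 1" "\<And>x n. \<bar>x\<bar> \<le> s \<Longrightarrow> \<bar>poly (ultra_poly a \<nu> n) x\<bar> \<le> K ^ n"
proof -
  have "Bseq (ultra_omega a \<nu>)"
    using ultra_omega_tendsto by (intro convergent_imp_Bseq convergentI)
  then obtain W where W: "W > 0" "\<And>n. \<bar>ultra_omega a \<nu> n\<bar> \<le> W"
    by (auto simp: Bseq_def)
  \<comment> \<open>Chosen so that K^2 dominates |s| K + W, the factor produced by one step of the
    recurrence.\<close>
  define K where "K = 1 + \<bar>s\<bar> + W"
  have K: "K \<ge> 1" "K\<^sup>2 \<ge> \<bar>s\<bar> * K + W"
  proof -
    show "K \<ge> 1" using W by (simp add: K_def)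
    then have "W * 1 \<le> W * K" using W by (intro mult_left_mono) auto
    moreover have "K\<^sup>2 = K + \<bar>s\<bar> * K + W * K"
      by (simp add: K_def power2_eq_square algebra_simps)
    ultimately show "K\<^sup>2 \<ge> \<bar>s\<bar> * K + W" using \<open>K \<ge> 1\<close> by linarith
  qed
  have "\<bar>poly (ultra_poly a \<nu> n) x\<bar> \<le> K ^ n" if "\<bar>x\<bar> \<le> s" for x n
  proof (induction n rule: induct_nat_012)
    case 1
    show ?case using that W by (simp add: K_def)
  next
    case (ge2 n)
    let ?p = "\<lambda>n. poly (ultra_poly a \<nu> n) x"
    have "\<bar>?p (Suc (Suc n))\<bar> \<le> \<bar>x\<bar> * \<bar>?p (Suc n)\<bar> + \<bar>ultra_omega a \<nu> (Suc n)\<bar> * \<bar>?p n\<bar>"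
      unfolding poly_ultra_poly_rec abs_mult[symmetric] by (rule abs_triangle_ineq4)
    also have "\<dots> \<le> \<bar>s\<bar> * K ^ Suc n + W * K ^ n"
      using ge2 that W K by (intro add_mono mult_mono) auto
    also have "\<dots> = K ^ n * (\<bar>s\<bar> * K + W)" by (simp add: algebra_simps)
    also have "\<dots> \<le> K ^ n * K\<^sup>2" using K by (intro mult_left_mono) auto
    finally show ?case by (simp add: power2_eq_square mult_ac)
  qed simp
  with K that show ?thesis by blast
qed

lemma gf_fps_nth_bound:
  assumes "l > 0"
  obtains K where "K \<ge> 1"
    "\<And>x n. \<bar>x\<bar> \<le> s \<Longrightarrow> cmod (fps_nth (gf_fps l (ultra_poly a \<nu>) x) n) \<le> K ^ n"
proof -
  obtain B where B: "B \<ge> 1" "\<And>x n. \<bar>x\<bar> \<le> s \<Longrightarrow> \<bar>poly (ultra_poly a \<nu> n) x\<bar> \<le> B ^ n"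
    using ultra_poly_bound[of s a \<nu>] by blast
  have "cmod (fps_nth (gf_fps l (ultra_poly a \<nu>) x) n) \<le> ((1 + l) * B) ^ n" if "\<bar>x\<bar> \<le> s" for x n
    using ultra_coeff_bound[OF assms, of n] B(2)[OF that, of n] assms B(1)
    by (auto simp: gf_fps_def norm_mult power_mult_distrib abs_mult intro!: mult_mono)
  moreover have "(1 + l) * B \<ge> 1" using assms B(1) mult_mono[of 1 "1 + l" 1 B] by simp
  ultimately show ?thesis using that by blast
qed

lemma fps_conv_radius_ge_of_bound:
  fixes f :: "complex fps"
  assumes "K > 0" "\<And>n. cmod (fps_nth f n) \<le> K ^ n"
  shows "fps_conv_radius f \<ge> 1 / K"
  unfolding fps_conv_radius_def
proof (rule conv_radius_geI_ex')
  fix \<rho> :: real assume \<rho>: "0 < \<rho>" "ereal \<rho> < ereal (1 / K)"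
  show "summable (\<lambda>n. fps_nth f n * of_real \<rho> ^ n)"
  proof (rule summable_comparison_test')
    show "summable (\<lambda>n. (K * \<rho>) ^ n)"
      using assms(1) \<rho> by (intro summable_geometric) (auto simp: field_simps)
    show "norm (fps_nth f n * of_real \<rho> ^ n) \<le> (K * \<rho>) ^ n" for n
      using assms(2)[of n] \<rho> by (simp add: norm_mult norm_power power_mult_distrib mult_right_mono)
  qed
qed

text \<open>By the differential equation, the left-hand side has derivative \<open>0\<close>.\<close>

lemma eval_gf_fps_ultra_poly:
  fixes a l x \<rho> :: real
  defines "\<theta> \<equiv> gf_fps l (ultra_poly a l) x"
  defines "Q \<equiv> \<lambda>z :: complex. 1 - of_real x * z + of_real a * z\<^sup>2"
  assumes "l > 0" "fps_conv_radius \<theta> \<ge> ereal \<rho>"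
    and pos: "\<And>z. cmod z < \<rho> \<Longrightarrow> Re (Q z) > 0" and z: "cmod z < \<rho>"
  shows "eval_fps \<theta> z * Q z powr of_real l = 1"
proof -
  define A where "A = [:1, - of_real x, of_real a :: complex:]"
  define B where "B = [:of_real (l * x), - of_real (2 * l * a) :: complex:]"
  have A: "poly A w = Q w" for w by (simp add: A_def Q_def power2_eq_square algebra_simps)
  have fA: "fps_of_poly A = 1 + fps_const (of_real a) * fps_X ^ 2 - fps_const (of_real x) * fps_X"
    by (simp add: A_def fps_of_poly_pCons power2_eq_square algebra_simps)
  have fB: "fps_of_poly B = fps_const (of_real l) * (fps_const (of_real x) - fps_deriv (1 + fps_const (of_real a) * fps_X ^ 2))"
    by (simp add: B_def fps_of_poly_pCons power2_eq_square algebra_simps flip: fps_const_mult)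
  have ode: "fps_of_poly A * fps_deriv \<theta> = fps_of_poly B * \<theta>"
    unfolding \<theta>_def fA fB by (rule gf_fps_ultra_poly_ode[OF assms(3)])
  have rad: "ereal (cmod w) < fps_conv_radius \<theta>" "ereal (cmod w) < fps_conv_radius (fps_deriv \<theta>)" if "cmod w < \<rho>" for w :: complex
  proof -
    have "ereal (cmod w) < ereal \<rho>" using that by simp
    also note assms(4)
    finally show "ereal (cmod w) < fps_conv_radius \<theta>" .
    also note fps_conv_radius_deriv
    finally show "ereal (cmod w) < fps_conv_radius (fps_deriv \<theta>)" .
  qed
  have ode': "Q w * eval_fps (fps_deriv \<theta>) w = of_real l * (of_real x - 2 * of_real a * w) * eval_fps \<theta> w"
    if "cmod w < \<rho>" for w
    using arg_cong[OF ode, of "\<lambda>F. eval_fps F w"] rad[OF that]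
    by (simp add: eval_fps_mult A) (simp add: B_def algebra_simps)
  have "\<exists>c. \<forall>w\<in>ball 0 \<rho>. eval_fps \<theta> w * Q w powr of_real l = c"
  proof (rule has_field_derivative_zero_constant)
    fix w :: complex assume "w \<in> ball 0 \<rho>"
    then have w: "cmod w < \<rho>" by simp
    then have Q: "Q w \<notin> \<real>\<^sub>\<le>\<^sub>0" "Q w \<noteq> 0" using pos[OF w] by (auto simp: complex_nonpos_Reals_iff)
    have Q': "(Q has_field_derivative 2 * of_real a * w - of_real x) (at w within ball 0 \<rho>)"
      unfolding Q_def by (auto intro!: derivative_eq_intros)
    have "((\<lambda>w. Q w powr of_real l) has_field_derivative
        of_real l * Q w powr (of_real l - 1) * (2 * of_real a * w - of_real x)) (at w within ball 0 \<rho>)"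
      using DERIV_chain2[OF has_field_derivative_powr[OF Q(1)] Q'] .
    from DERIV_mult[OF has_field_derivative_eval_fps[OF rad(1)[OF w]] this]
    have "((\<lambda>w. eval_fps \<theta> w * Q w powr of_real l) has_field_derivative
        eval_fps (fps_deriv \<theta>) w * Q w powr of_real l +
        of_real l * Q w powr (of_real l - 1) * (2 * of_real a * w - of_real x) * eval_fps \<theta> w)
        (at w within ball 0 \<rho>)" .
    moreover have "Q w powr of_real l = Q w powr (of_real l - 1) * Q w"
      using powr_add[of "Q w" "of_real l - 1" 1] Q(2) by simp
    then have "eval_fps (fps_deriv \<theta>) w * Q w powr of_real l +
        of_real l * Q w powr (of_real l - 1) * (2 * of_real a * w - of_real x) * eval_fps \<theta> w
      = Q w powr (of_real l - 1) * (Q w * eval_fps (fps_deriv \<theta>) w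
         + of_real l * (2 * of_real a * w - of_real x) * eval_fps \<theta> w)"
      by (simp add: algebra_simps)
    then have "eval_fps (fps_deriv \<theta>) w * Q w powr of_real l +
        of_real l * Q w powr (of_real l - 1) * (2 * of_real a * w - of_real x) * eval_fps \<theta> w = 0"
      unfolding ode'[OF w] by (simp add: algebra_simps)
    ultimately show "((\<lambda>w. eval_fps \<theta> w * Q w powr of_real l) has_field_derivative 0) (at w within ball 0 \<rho>)"
      by simp
  qed simp
  then obtain c where c: "\<And>w. cmod w < \<rho> \<Longrightarrow> eval_fps \<theta> w * Q w powr of_real l = c"
    by auto
  have "\<rho> > 0" using z norm_ge_zero[of z] by linarith
  then have "c = 1" using c[of 0] by (simp add: Q_def eval_fps_at_0 \<theta>_def gf_fps_def)
  with c z show ?thesis by simp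
qed

text \<open>The arguments lie in (0, pi) and (-pi, 0), so their sum stays in (-pi, pi) and the
  principal logarithm is additive. This is applied to z and f z - x.\<close>

lemma powr_mult_opposite_half_planes:
  assumes "Im z > 0" "Im w < 0"
  shows "(z * w) powr s = z powr s * w powr s"
proof -
  have nz: "z \<noteq> 0" "w \<noteq> 0" using assms by auto
  have "0 < Im (Ln z)" "Im (Ln z) < pi" using Im_Ln_pos_lt[OF nz(1)] assms by auto
  moreover have "- pi < Im (Ln w)" "Im (Ln w) < 0"
    using Im_Ln_pos_le[OF nz(2)] assms mpi_less_Im_Ln[OF nz(2)] Im_Ln_le_pi[OF nz(2)] by auto
  ultimately have "Ln (z * w) = Ln z + Ln w"
    using nz by (intro Ln_times_simple) auto
  then show ?thesis using nz by (simp add: powr_def exp_add algebra_simps)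
qed


text \<open>On the interval carrying M the terms are dominated by a geometric series independent of
  x, so the integral and the sum may be exchanged.\<close>

lemma interchange_conditionI:
  assumes "real_moment_measure M" "prob_space M" and supp: "AE x in M. \<bar>x\<bar> \<le> s"
    and K: "K > 0" "\<And>x n. \<bar>x\<bar> \<le> s \<Longrightarrow> cmod (fps_nth (gf_fps l P x) n) \<le> K ^ n"
    and S: "\<And>z. z \<in> S \<Longrightarrow> K * cmod z < 1"
  shows "interchange_condition M P l S"
proof -
  interpret real_moment_measure M by fact
  interpret prob_space M by fact
  have "integrable M (\<lambda>x. \<Sum>n. complex_of_real (pochhammer l n / fact n * (x ^ i * poly (P n) x)) * z ^ n) \<and>
        (\<lambda>n. complex_of_real (pochhammer l n / fact n * (\<integral>x. x ^ i * poly (P n) x \<partial>M)) * z ^ n) sums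
          (\<integral>x. (\<Sum>n. complex_of_real (pochhammer l n / fact n * (x ^ i * poly (P n) x)) * z ^ n) \<partial>M)"
    if z: "z \<in> S" for z i
  proof -
    define f where "f n x = complex_of_real (pochhammer l n / fact n * (x ^ i * poly (P n) x)) * z ^ n" for n x
    have int_real: "integrable M (\<lambda>x. x ^ i * poly (P n) x)" for n
      using integrable_poly_mult[of "monom 1 i" "P n"] by (simp add: poly_monom)
    have int: "integrable M (f n)" for n
      unfolding f_def by (intro integrable_mult_left integrable_of_real integrable_mult_right int_real)
    have bound: "norm (f n x) \<le> \<bar>s\<bar> ^ i * (K * cmod z) ^ n" if "\<bar>x\<bar> \<le> s" for n x
    proof -
      have "norm (f n x) = \<bar>x\<bar> ^ i * (cmod (fps_nth (gf_fps l P x) n) * cmod z ^ n)"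
        by (simp add: f_def gf_fps_def ultra_coeff_def norm_mult norm_power abs_mult power_abs norm_divide)
      also have "\<dots> \<le> \<bar>s\<bar> ^ i * (K ^ n * cmod z ^ n)"
        using K that by (intro mult_mono power_mono) auto
      finally show ?thesis by (simp add: power_mult_distrib)
    qed
    have geo: "summable (\<lambda>n. \<bar>s\<bar> ^ i * (K * cmod z) ^ n)"
      using S[OF z] K(1) by (intro summable_mult summable_geometric) auto
    have "AE x in M. summable (\<lambda>n. norm (f n x))"
      using supp
    proof eventually_elim
      case (elim x)
      show ?case by (rule summable_comparison_test'[OF geo]) (use bound[OF elim] in auto)
    qed
    moreover have "summable (\<lambda>n. \<integral>x. norm (f n x) \<partial>M)"
    proof (rule summable_comparison_test'[OF geo])
      fix n
      have "(\<integral>x. norm (f n x) \<partial>M) \<le> (\<integral>x. \<bar>s\<bar> ^ i * (K * cmod z) ^ n \<partial>M)"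
        by (rule integral_mono_AE) (use int bound supp in auto)
      then show "norm (\<integral>x. norm (f n x) \<partial>M) \<le> \<bar>s\<bar> ^ i * (K * cmod z) ^ n"
        by (simp add: prob_space)
    qed
    moreover have E: "(\<integral>x. f n x \<partial>M) =
        complex_of_real (pochhammer l n / fact n * (\<integral>x. x ^ i * poly (P n) x \<partial>M)) * z ^ n" for n
    proof -
      have "(\<integral>x. complex_of_real (g x) * w \<partial>M) = complex_of_real (\<integral>x. g x \<partial>M) * w" for g w
        by simp
      then show ?thesis unfolding f_def by (simp del: of_real_mult of_real_divide)
    qed
    ultimately have "integrable M (\<lambda>x. \<Sum>n. f n x)" "(\<lambda>n. \<integral>x. f n x \<partial>M) sums (\<integral>x. (\<Sum>n. f n x) \<partial>M)"
      using integrable_suminf[of M f] sums_integral[of M f] int by blast+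
    then show ?thesis unfolding E unfolding f_def ..
  qed
  then show ?thesis unfolding interchange_condition_def by blast
qed

text \<open>With H = 1 + a z^2 one has H - x z = z (f z - x). The witnesses are f z = 1/z + a z, u z
  = z powr l / V z and a small upper half-disc S, on which the power of this product splits without
  a branch correction. The factor V allows both families to be treated at once.\<close>

lemma exists_ultraspherical_gf:
  fixes l a :: real and V :: "complex poly"
  assumes "l > 0" "a > 0"
    and "real_moment_measure M" "prob_space M"
    and supp: "measure_supp M \<subseteq> {-s..s}" "AE x in M. \<bar>x\<bar> \<le> s"
    and gf: "\<And>x. gf_fps l (ultra_poly a \<nu>) x = fps_of_poly V * gf_fps l (ultra_poly a l) x"
    and V0: "poly V 0 = 1"
  shows "\<exists>S u f. ultraspherical_gf M (ultra_poly a \<nu>) l S u f \<and>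
    interchange_condition M (ultra_poly a \<nu>) l S \<and> (\<forall>z\<in>S. f z = 1 / z + of_real a * z)"
proof -
  let ?P = "ultra_poly a \<nu>"
  obtain K1 where K1: "K1 \<ge> 1" "\<And>x n. \<bar>x\<bar> \<le> s \<Longrightarrow> cmod (fps_nth (gf_fps l ?P x) n) \<le> K1 ^ n"
    using gf_fps_nth_bound[OF assms(1), of s a \<nu>] by blast
  obtain K2 where K2: "K2 \<ge> 1" "\<And>x n. \<bar>x\<bar> \<le> s \<Longrightarrow> cmod (fps_nth (gf_fps l (ultra_poly a l) x) n) \<le> K2 ^ n"
    using gf_fps_nth_bound[OF assms(1), of s a l] by blast
  obtain \<delta> where \<delta>: "\<delta> > 0" "\<And>z. cmod z < \<delta> \<Longrightarrow> poly V z \<noteq> 0"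
  proof -
    have "isCont (poly V) 0" by simp
    then have "(poly V \<longlongrightarrow> poly V 0) (nhds 0)"
      by (simp add: isCont_def flip: tendsto_at_iff_tendsto_nhds)
    then have "\<forall>\<^sub>F z in nhds 0. poly V z \<noteq> 0"
      using V0 by (intro tendsto_imp_eventually_ne) auto
    then show ?thesis using that unfolding eventually_nhds_metric by (auto simp: dist_norm)
  qed
  \<comment> \<open>Each summand ensures one property of the radius 1 / R: convergence of the two
    series (K1, K2), positivity of the real part of 1 - x z + a z^2 (|s| + a), and nonvanishing of V
    (1 / \<delta>).\<close>
  define R where "R = K1 + K2 + \<bar>s\<bar> + a + 1 / \<delta>"
  define \<rho> where "\<rho> = 1 / R"
  have "1 / \<delta> > 0" using \<delta>(1) by simp
  then have R: "R > K1" "R > K2" "R > \<bar>s\<bar> + a" "R > 1" "R > 1 / \<delta>"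
    unfolding R_def using K1(1) K2(1) assms(2) \<open>1 / \<delta> > 0\<close> by linarith+
  have \<rho>: "\<rho> > 0" "\<rho> < 1" "\<rho> < \<delta>" "K1 * \<rho> < 1" "K2 * \<rho> < 1" "(\<bar>s\<bar> + a) * \<rho> < 1"
    using R \<delta>(1) by (auto simp: \<rho>_def field_simps)
  define Q where "Q x z = 1 - of_real x * z + of_real a * z\<^sup>2" for x :: real and z :: complex
  have Qpos: "Re (Q x z) > 0" if "\<bar>x\<bar> \<le> s" "cmod z < \<rho>" for x z
  proof -
    have "cmod (of_real x * z - of_real a * z\<^sup>2) \<le> \<bar>x\<bar> * cmod z + a * (cmod z * cmod z)"
      using norm_triangle_ineq4[of "of_real x * z" "of_real a * z\<^sup>2"] assms(2)
      by (simp add: norm_mult norm_power power2_eq_square)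
    also have "\<dots> \<le> \<bar>s\<bar> * \<rho> + a * (\<rho> * 1)"
      using that \<rho> assms(2) by (intro add_mono mult_mono) auto
    also have "\<dots> < 1" using \<rho>(6) by (simp add: algebra_simps)
    finally have "\<bar>Re (of_real x * z - of_real a * z\<^sup>2)\<bar> < 1"
      using abs_Re_le_cmod le_less_trans by blast
    then show ?thesis by (simp add: Q_def)
  qed
  define S where "S = {z. Im z > 0} \<inter> ball 0 \<rho>"
  define u where "u z = z powr of_real l / poly V z" for z :: complex
  define f where "f z = 1 / z + of_real a * z" for z :: complex
  have S: "Im z > 0" "cmod z < \<rho>" "z \<noteq> 0" "z \<notin> \<real>\<^sub>\<le>\<^sub>0" if "z \<in> S" for z
    using that by (auto simp: S_def complex_nonpos_Reals_iff)
  have "open S" unfolding S_def by (intro open_Int open_halfspace_Im_gt open_ball)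
  \<comment> \<open>The imaginary part is Im z (a - 1 / |z|^2), which is negative as soon as a |z|^2
    < 1.\<close>
  have im: "Im (f z - of_real x) < 0" if "z \<in> S" for z x
  proof -
    have "a * (cmod z)\<^sup>2 < 1"
    proof -
      have "a * (cmod z)\<^sup>2 \<le> a * (\<rho> * 1)"
        unfolding power2_eq_square using S[OF that] \<rho> assms(2) by (intro mult_mono) auto
      also have "\<dots> \<le> (\<bar>s\<bar> + a) * \<rho>" using \<rho> by (simp add: algebra_simps)
      finally show ?thesis using \<rho>(6) by simp
    qed
    then have "a < 1 / (cmod z)\<^sup>2" using S(3)[OF that] by (simp add: field_simps)
    then have "Im z * a < Im z * (1 / (cmod z)\<^sup>2)" using S(1)[OF that] by (intro mult_strict_left_mono)
    moreover have "Im (f z - of_real x) = Im z * a - Im z * (1 / (cmod z)\<^sup>2)"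
      by (simp add: f_def Im_divide cmod_power2)
    ultimately show ?thesis by simp
  qed
  have "ultraspherical_gf M ?P l S u f"
    unfolding ultraspherical_gf_def
  proof (intro conjI ballI)
    show "connected S"
      unfolding S_def by (intro convex_connected convex_Int convex_halfspace_Im_gt convex_ball)
    have "closure S \<noteq> {} \<and> 0 \<in> closure S"
      unfolding closure_approachable
    proof (intro conjI allI impI)
      show "\<exists>y\<in>S. dist y 0 < e" if "e > 0" for e
        by (rule bexI[of _ "\<i> * of_real (min e \<rho> / 2)"])
          (use that \<rho>(1) in \<open>auto simp: S_def norm_mult min_def\<close>)
      from this[of 1] show "closure S \<noteq> {}" by auto
    qed
    then show "S \<noteq> {}" "0 \<in> closure S" by auto
    show "S \<inter> \<real>\<^sub>\<le>\<^sub>0 = {}" using S by auto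
    have V: "poly V z \<noteq> 0" if "z \<in> S" for z using S[OF that] \<delta>(2) \<rho>(3) by simp
    show "u analytic_on S"
      unfolding analytic_on_open[OF \<open>open S\<close>] u_def using S V
      by (intro holomorphic_intros) auto
    show "f analytic_on S"
      unfolding analytic_on_open[OF \<open>open S\<close>] f_def using S
      by (intro holomorphic_intros) auto
    show "u z \<noteq> 0" if "z \<in> S" for z using S[OF that] V[OF that] by (auto simp: u_def)
    show "Im (f z) \<noteq> 0" if "z \<in> S" for z using im[OF that, of 0] by simp
    have "((\<lambda>z. 1 + of_real a * z\<^sup>2) \<longlongrightarrow> 1 + of_real a * 0\<^sup>2) (at (0::complex) within S)"
      by (intro tendsto_intros)
    then have "((\<lambda>z. 1 + of_real a * z\<^sup>2) \<longlongrightarrow> 1) (at (0::complex) within S)"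
      by simp
    then show "((\<lambda>z. z * f z) \<longlongrightarrow> 1) (at 0 within S)"
      by (rule Lim_transform_eventually)
        (auto simp: eventually_at_filter f_def field_simps power2_eq_square)
    have "((\<lambda>z. 1 / poly V z) \<longlongrightarrow> 1 / poly V 0) (at 0 within S)"
      using V0 by (intro tendsto_intros) auto
    then show "((\<lambda>z. u z / z powr complex_of_real l) \<longlongrightarrow> 1) (at 0 within S)"
      using V0 by (auto intro: Lim_transform_eventually simp: eventually_at_filter u_def)
    fix x z assume x: "x \<in> measure_supp M" and z: "z \<in> S"
    have xs: "\<bar>x\<bar> \<le> s" using subsetD[OF supp(1) x] by auto
    have "ereal (cmod z) < 1 / K1"
      using S(2)[OF z] \<rho>(4) K1(1) by (simp add: field_simps) (metis less_trans mult_less_cancel_left_pos not_one_le_zero order_less_le_trans zero_less_one)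
    also have "\<dots> \<le> fps_conv_radius (gf_fps l ?P x)"
      using fps_conv_radius_ge_of_bound[of K1 "gf_fps l ?P x"] K1 xs by auto
    finally have sums: "(\<lambda>n. fps_nth (gf_fps l ?P x) n * z ^ n) sums eval_fps (gf_fps l ?P x) z"
      by (rule sums_eval_fps)
    have \<rho>2: "ereal \<rho> \<le> 1 / K2" using \<rho>(5) K2(1) by (simp add: field_simps)
    also have rad: "\<dots> \<le> fps_conv_radius (gf_fps l (ultra_poly a l) x)"
      using fps_conv_radius_ge_of_bound[of K2 "gf_fps l (ultra_poly a l) x"] K2 xs by auto
    finally have rad: "ereal \<rho> \<le> fps_conv_radius (gf_fps l (ultra_poly a l) x)" .
    moreover have "ereal (cmod z) < ereal \<rho>" using S[OF z] by simp
    ultimately have radz: "ereal (cmod z) < fps_conv_radius (gf_fps l (ultra_poly a l) x)"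
      by (metis less_le_trans)
    have "eval_fps (gf_fps l (ultra_poly a l) x) z * Q x z powr of_real l = 1"
      using eval_gf_fps_ultra_poly[OF assms(1) rad _ S(2)[OF z]] Qpos[OF xs] by (simp add: Q_def)
    moreover have "Q x z = z * (f z - of_real x)"
      using S[OF z] by (simp add: Q_def f_def field_simps power2_eq_square)
    then have "Q x z powr of_real l = z powr of_real l * (f z - of_real x) powr of_real l"
      using powr_mult_opposite_half_planes[OF S(1)[OF z] im[OF z]] by simp
    ultimately have "eval_fps (gf_fps l (ultra_poly a l) x) z *
        (z powr of_real l * (f z - of_real x) powr of_real l) = 1" by simp
    then have "eval_fps (gf_fps l (ultra_poly a l) x) z =
        1 / (z powr of_real l * (f z - of_real x) powr of_real l)"
      by (metis div_by_0 mult_zero_right nonzero_eq_divide_eq zero_neq_one)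
    then have "eval_fps (gf_fps l ?P x) z = 1 / (u z * (f z - of_real x) powr of_real l)"
      using radz by (simp add: gf eval_fps_mult u_def)
    then show "(\<lambda>n. complex_of_real (pochhammer l n / fact n * poly (?P n) x) * z ^ n) sums
          (1 / (u z * (f z - complex_of_real x) powr complex_of_real l))"
      using sums by (simp add: gf_fps_def ultra_coeff_def)
  qed fact
  moreover have "interchange_condition M ?P l S"
  proof (rule interchange_conditionI[OF assms(3,4) supp(2) _ K1(2)])
    fix z assume "z \<in> S"
    then have "K1 * cmod z \<le> K1 * \<rho>" using S[of z] K1(1) by (intro mult_left_mono) auto
    then show "K1 * cmod z < 1" using \<rho>(4) by simp
  qed (use K1 in auto)
  ultimately show ?thesis unfolding f_def by blast
qed

section \<open>Consequences of a generating function of ultraspherical type\<close>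

text \<open>The reflected polynomials (-1)^n P n (-x) are again monic orthogonal, so uniqueness
  gives P n the parity of n. Replacing x by -x in the recurrence then reverses the sign of the
  \<alpha> term relative to all the others.\<close>

lemma symmetric_jacobi_szego:
  assumes M: "standard_measure M" "symmetric_measure M" "infinite (measure_supp M)"
    and P: "monic_orthogonal M P" and J: "jacobi_szego P \<alpha> \<omega>"
  shows "\<alpha> n = 0"
proof -
  interpret real_moment_measure M
    using M(1) by unfold_locales (auto simp: standard_measure_def)
  define Q where "Q n = smult ((-1) ^ n) (P n \<circ>\<^sub>p [:0, -1:])" for n
  have Q: "poly (Q n) x = (-1) ^ n * poly (P n) (- x)" for n x
    by (simp add: Q_def poly_pcompose)
  have monicP: "degree (P n) = n" "coeff (P n) n = 1" for n
    using P unfolding monic_orthogonal_def by metis+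
  have "monic_orthogonal M Q"
    unfolding monic_orthogonal_def
  proof (intro conjI allI impI)
    fix n
    show d: "degree (Q n) = n"
      by (simp add: Q_def degree_pcompose monicP)
    have "lead_coeff (Q n) = (-1) ^ n * lead_coeff (P n \<circ>\<^sub>p [:0, -1:])"
      by (simp add: Q_def)
    also have "\<dots> = (-1) ^ n * (-1) ^ n"
      by (subst lead_coeff_comp) (auto simp: monicP)
    finally show "lead_coeff (Q n) = 1" by (simp flip: power_mult_distrib)
  next
    fix n m :: nat assume "n \<noteq> m"
    have "(\<integral>x. poly (P n) x * poly (P m) x \<partial>M) = (\<integral>x. poly (P n) x * poly (P m) x \<partial>distr M borel uminus)"
      using M(2) by (simp add: symmetric_measure_def)
    also have "\<dots> = (\<integral>x. poly (P n) (- x) * poly (P m) (- x) \<partial>M)"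
    proof (rule integral_distr)
      show "(\<lambda>x. poly (P n) x * poly (P m) x) \<in> borel_measurable borel"
        unfolding poly_altdef by measurable
    qed simp
    finally have "(\<integral>x. poly (P n) (- x) * poly (P m) (- x) \<partial>M) = 0"
      using P \<open>n \<noteq> m\<close> by (simp add: monic_orthogonal_def)
    moreover have "(\<integral>x. poly (Q n) x * poly (Q m) x \<partial>M) =
        (\<integral>x. ((-1) ^ n * (-1) ^ m) * (poly (P n) (- x) * poly (P m) (- x)) \<partial>M)"
      by (simp add: Q mult_ac)
    ultimately show "(\<integral>x. poly (Q n) x * poly (Q m) x \<partial>M) = 0" by simp
  qed
  from monic_orthogonal_unique[OF M(3) this P] have refl: "(-1) ^ n * poly (P n) (- x) = poly (P n) x" for n x
    using Q[of n x] by simp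
  have neg: "poly (P n) (- x) = (-1) ^ n * poly (P n) x" for n x
    using refl[of n "- x"] by simp
  have rec: "x * poly (P n) x = poly (P (Suc n)) x + \<alpha> n * poly (P n) x +
      (if n = 0 then 0 else \<omega> n * poly (P (n - 1)) x)" for x
    using arg_cong[OF J[unfolded jacobi_szego_def, rule_format, of n], of "\<lambda>p. poly p x"]
    by (cases "n = 0") auto
  have "\<alpha> n * poly (P n) x = 0" for x
  proof -
    have "(-1) ^ n * (x * poly (P n) x - poly (P (Suc n)) x + \<alpha> n * poly (P n) x -
        (if n = 0 then 0 else \<omega> n * poly (P (n - 1)) x)) = 0"
      using rec[of "- x"] unfolding neg by (cases n) (simp_all add: algebra_simps)
    then show ?thesis using rec[of x] by simp
  qed
  then have "smult (\<alpha> n) (P n) = 0"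
    unfolding poly_eq_poly_eq_iff[symmetric] by (simp add: fun_eq_iff)
  then show ?thesis using monicP(2)[of n] by auto
qed

text \<open>Orthogonality to P 0, P 1 and P 2 = x^2 - 1 determines all integrals of P n against 1, x
  and x^2. The parameter \<open>\<omega> 2\<close> is the squared norm of P 2, positive because the
  support is infinite; in the second family this positivity yields l > 1/2.\<close>

lemma symmetric_low_moments:
  assumes M: "standard_measure M" "symmetric_measure M" "infinite (measure_supp M)"
    and P: "monic_orthogonal M P" and J: "jacobi_szego P \<alpha> \<omega>"
  shows "\<omega> 2 > 0"
    and "(\<integral>x. x ^ 0 * poly (P n) x \<partial>M) = (if n = 0 then 1 else 0)"
    and "(\<integral>x. x ^ 1 * poly (P n) x \<partial>M) = (if n = 1 then 1 else 0)"
    and "(\<integral>x. x ^ 2 * poly (P n) x \<partial>M) = (if n = 0 then 1 else if n = 2 then \<omega> 2 else 0)"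
proof -
  interpret real_moment_measure M
    using M(1) by unfold_locales (auto simp: standard_measure_def)
  interpret prob_space M using M(1) by (simp add: standard_measure_def)
  have orth: "(\<integral>x. poly (P n) x * poly (P m) x \<partial>M) = 0" if "n \<noteq> m" for n m
    using P that by (simp add: monic_orthogonal_def)
  have "degree (P 0) = 0" "lead_coeff (P 0) = 1" using P unfolding monic_orthogonal_def by blast+
  then have P0: "P 0 = 1" by (metis degree_eq_zeroE lead_coeff_pCons(2) one_pCons)
  note rec = J[unfolded jacobi_szego_def symmetric_jacobi_szego[OF M P J], rule_format]
  have P1: "P 1 = [:0, 1:]" using rec[of 0] by (simp add: P0)
  have P2: "P 2 = [:- \<omega> 1, 0, 1:]"
  proof -
    have "P 2 = [:0, 1:] * P 1 - smult (\<omega> 1) (P 0)"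
      using rec[of 1] by (simp add: numeral_2_eq_2)
    then show ?thesis by (simp add: P0 P1[unfolded One_nat_def] one_pCons)
  qed
  have std: "(\<integral>x. x \<partial>M) = 0" "(\<integral>x. x\<^sup>2 \<partial>M) = 1" using M(1) by (auto simp: standard_measure_def)
  have "(\<integral>x. poly (P 2) x * poly (P 0) x \<partial>M) = (\<integral>x. x\<^sup>2 - \<omega> 1 \<partial>M)"
    by (simp add: P0 P2 power2_eq_square algebra_simps)
  also have "\<dots> = 1 - \<omega> 1" using integrable_power[of 2] std prob_space by simp
  finally have w1: "\<omega> 1 = 1" using orth[of 2 0] by simp
  have sq: "(\<integral>x. poly (P 2) x * poly (P 2) x \<partial>M) = \<omega> 2"
  proof -
    have p3: "poly (P 3) x = x * poly (P 2) x - \<omega> 2 * x" for x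
      using arg_cong[OF rec[of 2], of "\<lambda>p. poly p x"] by (simp add: P1[unfolded One_nat_def] eval_nat_numeral)
    \<comment> \<open>Write P 2 = x^2 - 1 in one factor and use x P 2 = P 3 + \<omega> 2 P 1; only
      the term with x^2 has a nonzero integral.\<close>
    have "poly (P 2) x * poly (P 2) x = poly (P 3) x * poly (P 1) x + \<omega> 2 * x\<^sup>2 - poly (P 2) x * poly (P 0) x" for x
      unfolding p3 by (simp add: P0 P1[unfolded One_nat_def] P2 w1[unfolded One_nat_def] power2_eq_square algebra_simps)
    then have "(\<integral>x. poly (P 2) x * poly (P 2) x \<partial>M) =
        (\<integral>x. poly (P 3) x * poly (P 1) x + \<omega> 2 * x\<^sup>2 - poly (P 2) x * poly (P 0) x \<partial>M)" by simp
    also have "\<dots> = (\<integral>x. poly (P 3) x * poly (P 1) x \<partial>M) + \<omega> 2 * (\<integral>x. x\<^sup>2 \<partial>M) - (\<integral>x. poly (P 2) x * poly (P 0) x \<partial>M)"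
      using integrable_power[of 2]
      by (subst Bochner_Integration.integral_diff Bochner_Integration.integral_add, (auto)[2])+ simp
    finally show ?thesis using orth[of 3 1] orth[of 2 0] std by simp
  qed
  have "P 2 \<noteq> 0" by (simp add: P2)
  then have "\<omega> 2 \<noteq> 0" using poly_eq_0_if_integral_square_eq_0[OF M(3), of "P 2"] sq by auto
  moreover have "\<omega> 2 \<ge> 0" unfolding sq[symmetric] by (intro Bochner_Integration.integral_nonneg) simp
  ultimately show "\<omega> 2 > 0" by simp
  have z: "(\<integral>x. poly (P 0) x * poly (P n) x \<partial>M) = (if n = 0 then 1 else 0)" for n
    using orth[of 0 n] prob_space by (auto simp: P0)
  then show "(\<integral>x. x ^ 0 * poly (P n) x \<partial>M) = (if n = 0 then 1 else 0)" by (simp add: P0)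
  show "(\<integral>x. x ^ 1 * poly (P n) x \<partial>M) = (if n = 1 then 1 else 0)"
    using orth[of 1 n] std(2) P1 by (auto simp: power2_eq_square)
  have "x ^ 2 * poly (P n) x = poly (P 2) x * poly (P n) x + poly (P 0) x * poly (P n) x" for x
    by (simp add: P0 P2 w1[unfolded One_nat_def] power2_eq_square algebra_simps)
  then have "(\<integral>x. x ^ 2 * poly (P n) x \<partial>M) =
      (\<integral>x. poly (P 2) x * poly (P n) x \<partial>M) + (\<integral>x. poly (P 0) x * poly (P n) x \<partial>M)"
    by simp
  then show "(\<integral>x. x ^ 2 * poly (P n) x \<partial>M) = (if n = 0 then 1 else if n = 2 then \<omega> 2 else 0)"
    unfolding z using orth[of 2 n] sq by auto
qed

section \<open>The linear differential equation\<close>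

text \<open>Near z the product of \<psi>, u and (f - x) powr l is constantly 1. Differentiating and
  cancelling u (f - x) powr (l - 1) gives the equation. Since Im f is nonzero, f - x avoids the
  branch cut.\<close>

lemma gf_fps_log_derivative:
  assumes gf: "ultraspherical_gf M P l S u f" and x: "x \<in> measure_supp M" and z: "z \<in> S"
    and rad: "ereal (cmod z) < fps_conv_radius (gf_fps l P x)"
  shows "eval_fps (fps_deriv (gf_fps l P x)) z * (f z - of_real x)
    + eval_fps (gf_fps l P x) z * (deriv u z / u z) * (f z - of_real x)
    + of_real l * eval_fps (gf_fps l P x) z * deriv f z = 0"
proof -
  let ?\<psi> = "gf_fps l P x"
  have S: "open S" "u holomorphic_on S" "f holomorphic_on S"
    "\<And>w. w \<in> S \<Longrightarrow> u w \<noteq> 0" "\<And>w. w \<in> S \<Longrightarrow> Im (f w) \<noteq> 0"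
    using gf by (auto simp: ultraspherical_gf_def analytic_imp_holomorphic)
  have slit: "f w - of_real x \<notin> \<real>\<^sub>\<le>\<^sub>0" if "w \<in> S" for w
    using S(5)[OF that] by (auto simp: complex_nonpos_Reals_iff)
  let ?\<Phi> = "\<lambda>w. eval_fps ?\<psi> w * (u w * (f w - of_real x) powr of_real l)"
  have one: "?\<Phi> w = 1" if "w \<in> S \<inter> eball 0 (fps_conv_radius ?\<psi>)" for w
  proof -
    have "(\<lambda>n. fps_nth ?\<psi> n * w ^ n) sums (1 / (u w * (f w - of_real x) powr of_real l))"
      using gf x that by (simp add: ultraspherical_gf_def gf_fps_def ultra_coeff_def)
    moreover have "(\<lambda>n. fps_nth ?\<psi> n * w ^ n) sums eval_fps ?\<psi> w"
      using that by (intro sums_eval_fps) (simp add: in_eball_iff)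
    ultimately have "eval_fps ?\<psi> w = 1 / (u w * (f w - of_real x) powr of_real l)"
      by (metis sums_unique2)
    moreover have "u w * (f w - of_real x) powr of_real l \<noteq> 0"
    proof -
      have "f w \<noteq> of_real x" using S(5)[of w] that by auto
      then show ?thesis using S(4)[of w] that by auto
    qed
    ultimately show ?thesis by simp
  qed
  define g where "g = f z - of_real x"
  define F where "F = eval_fps ?\<psi> z"
  define F' where "F' = eval_fps (fps_deriv ?\<psi>) z"
  have u': "(u has_field_derivative deriv u z) (at z)" and f': "(f has_field_derivative deriv f z) (at z)"
    using S z by (auto intro: holomorphic_derivI)
  have "((\<lambda>w. f w - of_real x) has_field_derivative deriv f z) (at z)"
    using f' by (auto intro!: derivative_eq_intros)
  from DERIV_chain2[OF has_field_derivative_powr[OF slit[OF z]] this]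
  have p': "((\<lambda>w. (f w - of_real x) powr of_real l) has_field_derivative
      of_real l * g powr (of_real l - 1) * deriv f z) (at z)" by (simp add: g_def)
  have "(?\<Phi> has_field_derivative
      F' * (u z * g powr of_real l) +
      (deriv u z * g powr of_real l + of_real l * g powr (of_real l - 1) * deriv f z * u z) * F) (at z)"
    using DERIV_mult[OF has_field_derivative_eval_fps[OF rad] DERIV_mult[OF u' p']]
    by (simp add: F_def F'_def g_def)
  moreover have "(?\<Phi> has_field_derivative 0) (at z)"
  proof (rule has_field_derivative_transform_within_open)
    show "((\<lambda>_. 1) has_field_derivative 0) (at z)" by simp
    show "open (S \<inter> eball 0 (fps_conv_radius ?\<psi>))" using S(1) by auto
    show "z \<in> S \<inter> eball 0 (fps_conv_radius ?\<psi>)" using z rad by (simp add: in_eball_iff)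
  qed (use one in auto)
  ultimately have "F' * (u z * g powr of_real l) +
      (deriv u z * g powr of_real l + of_real l * g powr (of_real l - 1) * deriv f z * u z) * F = 0"
    by (rule DERIV_unique)
  moreover have "g \<noteq> 0" using slit[OF z] by (auto simp: g_def)
  then have "g powr of_real l = g powr (of_real l - 1) * g"
    using powr_add[of g "of_real l - 1" 1] by simp
  ultimately have "g powr (of_real l - 1) * u z * (F' * g + F * (deriv u z / u z) * g + of_real l * F * deriv f z) = 0"
    using S(4)[OF z] by (simp add: field_simps)
  then show ?thesis
    using S(4)[OF z] \<open>g \<noteq> 0\<close> by (simp add: g_def F_def F'_def)
qed

text \<open>One fixed nonzero z in S works for every x: convergence of the power series at z bounds
  each radius below by |z|.\<close>

lemma ultraspherical_gf_conv_radius: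
  assumes "ultraspherical_gf M P l S u f"
  obtains R where "R > 0" "\<And>x. x \<in> measure_supp M \<Longrightarrow> ereal R \<le> fps_conv_radius (gf_fps l P x)"
proof -
  from assms obtain z where z: "z \<in> S" "z \<noteq> 0" unfolding ultraspherical_gf_def by fastforce
  show ?thesis
  proof
    show "cmod z > 0" using z by simp
    fix x assume "x \<in> measure_supp M"
    then have "(\<lambda>n. complex_of_real (pochhammer l n / fact n * poly (P n) x) * z ^ n) sums
        (1 / (u z * (f z - complex_of_real x) powr complex_of_real l))"
      using assms z(1) unfolding ultraspherical_gf_def by blast
    then have "summable (\<lambda>n. fps_nth (gf_fps l P x) n * z ^ n)"
      by (simp add: gf_fps_def ultra_coeff_def sums_summable)
    then show "ereal (cmod z) \<le> fps_conv_radius (gf_fps l P x)"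
      unfolding fps_conv_radius_def by (rule conv_radius_geI)
  qed
qed

text \<open>Eliminating \<open>u' / u\<close> between two points \<open>x, y\<close> of the support leaves an identity between
  functions that are holomorphic at \<open>0\<close>, hence between power series.\<close>

lemma gf_fps_elimination:
  fixes H :: "complex poly"
  assumes gf: "ultraspherical_gf M P l S u f" and f: "\<And>z. z \<in> S \<Longrightarrow> f z = poly H z / z"
    and xy: "x \<in> measure_supp M" "y \<in> measure_supp M"
  defines "\<psi> \<equiv> gf_fps l P" and "G \<equiv> \<lambda>x. fps_of_poly H - fps_const (complex_of_real x) * fps_X"
  shows "G x * G y * (fps_deriv (\<psi> x) * \<psi> y - \<psi> x * fps_deriv (\<psi> y)) =
    fps_const (of_real l) * (fps_X * fps_deriv (fps_of_poly H) - fps_of_poly H)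
      * fps_const (of_real y - of_real x) * \<psi> x * \<psi> y"
proof -
  obtain R where R: "R > 0" "\<And>x. x \<in> measure_supp M \<Longrightarrow> ereal R \<le> fps_conv_radius (\<psi> x)"
    using ultraspherical_gf_conv_radius[OF gf] unfolding \<psi>_def by blast
  have rad': "ereal R \<le> fps_conv_radius (fps_deriv (\<psi> x))" if "x \<in> measure_supp M" for x
    using R(2)[OF that] fps_conv_radius_deriv order_trans by blast
  define A where "A x = H - [:0, of_real x:]" for x
  define B where "B = smult (of_real l * (of_real y - of_real x)) ([:0, 1:] * pderiv H - H)"
  define F F' where "F x z = eval_fps (\<psi> x) z" and "F' x z = eval_fps (fps_deriv (\<psi> x)) z" for x z
  define D where "D = G x * G y * (fps_deriv (\<psi> x) * \<psi> y - \<psi> x * fps_deriv (\<psi> y)) -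
    fps_const (of_real l) * (fps_X * fps_deriv (fps_of_poly H) - fps_of_poly H)
      * fps_const (of_real y - of_real x) * \<psi> x * \<psi> y"
  define g where "g z = poly (A x) z * poly (A y) z * (F' x z * F y z - F x z * F' y z)
    - poly B z * F x z * F y z" for z
  have G: "G x = fps_of_poly (A x)" for x
    by (simp add: G_def A_def fps_of_poly_diff fps_of_poly_pCons)
  have B: "fps_of_poly B = fps_const (of_real l) * (fps_X * fps_deriv (fps_of_poly H) - fps_of_poly H)
      * fps_const (of_real y - of_real x)"
    by (simp add: B_def fps_of_poly_smult fps_of_poly_mult fps_of_poly_diff fps_of_poly_pCons
      fps_of_poly_pderiv mult_ac flip: fps_const_mult)
  have pos: "fps_conv_radius (\<psi> x) > 0" "fps_conv_radius (fps_deriv (\<psi> x)) > 0" if "x \<in> measure_supp M" for x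
    using R(1) R(2)[OF that] rad'[OF that] by (meson ereal_less(2) less_le_trans)+
  have sub: "ball 0 R \<subseteq> eball 0 (fps_conv_radius (\<psi> x))"
    and sub': "ball 0 R \<subseteq> eball 0 (fps_conv_radius (fps_deriv (\<psi> x)))" if "x \<in> measure_supp M" for x
    using ball_eball_mono[OF R(2)[OF that]] ball_eball_mono[OF rad'[OF that]] .
  have "g has_fps_expansion D"
    unfolding g_def D_def G B[symmetric] F_def F'_def
    using pos[OF xy(1)] pos[OF xy(2)]
    by (intro has_fps_expansion_mult has_fps_expansion_diff eval_fps_has_fps_expansion)
      (auto simp: has_fps_expansion_def)
  \<comment> \<open>The point 0 lies outside S but is a limit point of it, so the identity theorem
    carries the vanishing of g from S to the whole disc.\<close>
  moreover have "g z = 0" if z: "z \<in> ball 0 R" for z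
  proof (rule analytic_continuation[where f = g and S = "ball 0 R" and U = "S \<inter> ball 0 R" and \<xi> = 0])
    show "g holomorphic_on ball 0 R"
      unfolding g_def F_def F'_def
      by (intro holomorphic_intros holomorphic_on_eval_fps sub sub' xy)
    have "0 \<in> closure S" "0 \<notin> S" using gf by (auto simp: ultraspherical_gf_def)
    then have "0 islimpt S" by (simp add: closure_def)
    then show "0 islimpt S \<inter> ball 0 R"
      using R(1) by (intro islimpt_Int_eventually eventually_at_in_open') auto
    fix w assume w: "w \<in> S \<inter> ball 0 R"
    then have "w \<noteq> 0" using \<open>0 \<notin> S\<close> by auto
    have rw: "ereal (cmod w) < fps_conv_radius (\<psi> x)" if "x \<in> measure_supp M" for x
      using w R(2)[OF that] by (auto intro: less_le_trans[of _ "ereal R"])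
    define q d where "q = deriv u w / u w" and "d = deriv f w"
    have e: "F' t w * (f w - of_real t) + F t w * q * (f w - of_real t) + of_real l * F t w * d = 0"
      if "t \<in> measure_supp M" for t
      using gf_fps_log_derivative[OF gf that _ rw[OF that, unfolded \<psi>_def]] w
      by (simp add: F_def F'_def \<psi>_def q_def d_def)
    have A: "poly (A t) w = w * (f w - of_real t)" for t
      using f[of w] w \<open>w \<noteq> 0\<close> by (simp add: A_def field_simps)
    have "(f has_field_derivative (w * poly (pderiv H) w - poly H w) / w\<^sup>2) (at w)"
    proof (rule has_field_derivative_transform_within_open[where S = S])
      show "((\<lambda>z. poly H z / z) has_field_derivative (w * poly (pderiv H) w - poly H w) / w\<^sup>2) (at w)"
        using \<open>w \<noteq> 0\<close> by (auto intro!: derivative_eq_intros simp: power2_eq_square mult_ac)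
    qed (use w f gf in \<open>auto simp: ultraspherical_gf_def\<close>)
    then have d: "w * poly (pderiv H) w - poly H w = w\<^sup>2 * d"
      using \<open>w \<noteq> 0\<close> DERIV_imp_deriv[of f] by (simp add: d_def)
    define a b where "a = f w - of_real x" and "b = f w - of_real y"
    have "poly B w = of_real l * (of_real y - of_real x) * (w * poly (pderiv H) w - poly H w)"
      by (simp add: B_def)
    also have "of_real y - of_real x = a - b" by (simp add: a_def b_def)
    finally have Bw: "poly B w = of_real l * (a - b) * (w\<^sup>2 * d)" unfolding d .
    \<comment> \<open>Cross-multiplying the logarithmic derivative equations at x and y cancels the
      terms with q = u' / u.\<close>
    have "g w = w\<^sup>2 * ((F' x w * a + F x w * q * a + of_real l * F x w * d) * F y w * b
        - (F' y w * b + F y w * q * b + of_real l * F y w * d) * F x w * a)"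
      unfolding g_def A Bw a_def[symmetric] b_def[symmetric]
      by (simp add: power2_eq_square algebra_simps)
    then show "g w = 0"
      using e[OF xy(1)] e[OF xy(2)] unfolding a_def[symmetric] b_def[symmetric] by simp
  qed (use z R(1) in auto)
  then have "eventually (\<lambda>z. g z = 0) (nhds 0)"
    using R(1) by (auto simp: eventually_nhds_metric dist_norm)
  ultimately have "D = 0"
    by (intro eval_fps_eqD) (auto simp: has_fps_expansion_def elim: eventually_elim2)
  then show ?thesis unfolding D_def by simp
qed

text \<open>Fix y in the support and define W by solving the equation at y. This is possible in
  formal power series because V has constant term 1. The elimination identity carries the equation
  over to every other x with the same W.\<close>

lemma gf_fps_linear_ode:
  fixes H :: "complex poly"
  assumes gf: "ultraspherical_gf M P l S u f" and f: "\<And>z. z \<in> S \<Longrightarrow> f z = poly H z / z"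
    and H0: "poly H 0 = 1" and ne: "measure_supp M \<noteq> {}" and P0: "P 0 = 1"
  obtains W where "\<And>x. x \<in> measure_supp M \<Longrightarrow>
    fps_X * fps_deriv (gf_fps l P x) * (fps_of_poly H - fps_const (complex_of_real x) * fps_X)
     + (W * (fps_of_poly H - fps_const (of_real x) * fps_X)
        + fps_const (of_real l) * (fps_X * fps_deriv (fps_of_poly H) - fps_of_poly H)) * gf_fps l P x = 0"
proof -
  obtain y where y: "y \<in> measure_supp M" using ne by blast
  define \<psi> where "\<psi> = gf_fps l P"
  define G where "G x = fps_of_poly H - fps_const (complex_of_real x) * fps_X" for x
  define N where "N = fps_const (of_real l) * (fps_X * fps_deriv (fps_of_poly H) - fps_of_poly H)"
  define V where "V = G y * \<psi> y"
  define W where "W = - (fps_X * fps_deriv (\<psi> y) * G y + N * \<psi> y) * inverse V"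
  have V0: "fps_nth V 0 \<noteq> 0"
    using H0 by (simp add: V_def G_def \<psi>_def gf_fps_def P0 poly_0_coeff_0)
  have WV: "W * V = - (fps_X * fps_deriv (\<psi> y) * G y + N * \<psi> y)"
    using inverse_mult_eq_1[OF V0] by (simp add: W_def mult.assoc)
  show ?thesis
  proof
    fix x assume x: "x \<in> measure_supp M"
    have el: "G x * G y * (fps_deriv (\<psi> x) * \<psi> y - \<psi> x * fps_deriv (\<psi> y)) =
        N * fps_const (of_real y - of_real x) * \<psi> x * \<psi> y"
      using gf_fps_elimination[OF gf f x y] by (simp add: G_def N_def \<psi>_def)
    have Gd: "G y - G x = - (fps_const (of_real y - of_real x) * fps_X)"
    proof -
      have "(h - b * t) - (h - a * t) = - ((b - a) * t)" for h a b t :: "complex fps"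
        by (simp add: algebra_simps)
      moreover have "fps_const (of_real y - of_real x) = fps_const (of_real y) - fps_const (complex_of_real x)"
        by (simp only: fps_const_sub)
      ultimately show ?thesis unfolding G_def by (simp only:)
    qed
    have "V * (fps_X * fps_deriv (\<psi> x) * G x + (W * G x + N) * \<psi> x) =
       fps_X * fps_deriv (\<psi> x) * G x * V + (W * V) * G x * \<psi> x + N * \<psi> x * V"
      by (simp add: algebra_simps)
    also have "\<dots> = fps_X * (G x * G y * (fps_deriv (\<psi> x) * \<psi> y - \<psi> x * fps_deriv (\<psi> y)))
        + N * \<psi> x * \<psi> y * (G y - G x)"
      unfolding WV by (simp add: V_def algebra_simps)
    also have "\<dots> = 0" unfolding el Gd by (simp add: algebra_simps)
    finally have "fps_X * fps_deriv (\<psi> x) * G x + (W * G x + N) * \<psi> x = 0"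
      using V0 by auto
    then show "fps_X * fps_deriv (gf_fps l P x) * (fps_of_poly H - fps_const (complex_of_real x) * fps_X)
     + (W * (fps_of_poly H - fps_const (of_real x) * fps_X)
        + fps_const (of_real l) * (fps_X * fps_deriv (fps_of_poly H) - fps_of_poly H)) * gf_fps l P x = 0"
      by (simp add: G_def N_def \<psi>_def)
  qed
qed

text \<open>Each coefficient of the product is a finite sum of polynomials in x, so linearity of the
  integral suffices.\<close>

lemma (in real_moment_measure) has_bochner_integral_gf_fps:
  fixes K :: "complex fps" and a :: "nat \<Rightarrow> real"
  shows "has_bochner_integral M
    (\<lambda>x. complex_of_real (x ^ i) * fps_nth (K * Abs_fps (\<lambda>n. complex_of_real (a n * poly (P n) x))) N)
    (fps_nth (K * Abs_fps (\<lambda>n. complex_of_real (a n * (\<integral>x. x ^ i * poly (P n) x \<partial>M)))) N)"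
proof -
  have "has_bochner_integral M (\<lambda>x. \<Sum>k=0..N. fps_nth K k * complex_of_real (a (N - k) * (x ^ i * poly (P (N - k)) x)))
     (\<Sum>k=0..N. fps_nth K k * complex_of_real (a (N - k) * (\<integral>x. x ^ i * poly (P (N - k)) x \<partial>M)))"
  proof (intro has_bochner_integral_sum has_bochner_integral_mult_right has_bochner_integral_of_real
      has_bochner_integral_integrable)
    fix k
    show "integrable M (\<lambda>x. x ^ i * poly (P (N - k)) x)"
      using integrable_poly_mult[of "monom 1 i" "P (N - k)"] by (simp add: poly_monom)
  qed
  then show ?thesis
    by (simp add: fps_mult_nth sum_distrib_left mult_ac)
qed

text \<open>The coefficients of the linear equation are polynomials in \<open>x\<close> that vanish on the support,
  so they may be integrated against \<open>1\<close> and \<open>x\<close>.\<close>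

lemma gf_fps_moment_equation:
  fixes W U :: "complex fps"
  assumes "real_moment_measure M"
    and ode: "\<And>x. x \<in> measure_supp M \<Longrightarrow>
      fps_X * fps_deriv (gf_fps l P x) * (h - fps_const (complex_of_real x) * fps_X)
     + (W * (h - fps_const (of_real x) * fps_X) + N) * gf_fps l P x = 0"
  defines "J \<equiv> \<lambda>i. Abs_fps (\<lambda>n. complex_of_real (ultra_coeff l n * (\<integral>x. x ^ i * poly (P n) x \<partial>M)))"
    and "J' \<equiv> \<lambda>i. Abs_fps (\<lambda>n. complex_of_real (real n * ultra_coeff l n * (\<integral>x. x ^ i * poly (P n) x \<partial>M)))"
  shows "h * J' i + (W * h + N) * J i - fps_X * J' (Suc i) - fps_X * W * J (Suc i) = 0"
proof (rule fps_ext)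
  fix n
  interpret real_moment_measure M by fact
  let ?\<psi> = "\<lambda>x. Abs_fps (\<lambda>n. complex_of_real (ultra_coeff l n * poly (P n) x))"
  let ?\<psi>' = "\<lambda>x. Abs_fps (\<lambda>n. complex_of_real (real n * ultra_coeff l n * poly (P n) x))"
  let ?I = "\<lambda>i K F x. complex_of_real (x ^ i) * fps_nth (K * F x) n"
  \<comment> \<open>The n-th coefficient of the equation times x^i. The explicit factors x of the
    equation are absorbed by raising i to i + 1.\<close>
  let ?g = "\<lambda>x. ?I i h ?\<psi>' x + ?I i (W * h + N) ?\<psi> x
    - ?I (Suc i) fps_X ?\<psi>' x - ?I (Suc i) (fps_X * W) ?\<psi> x"
  have hb: "has_bochner_integral M ?g (fps_nth (h * J' i) n + fps_nth ((W * h + N) * J i) n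
      - fps_nth (fps_X * J' (Suc i)) n - fps_nth (fps_X * W * J (Suc i)) n)"
    unfolding J_def J'_def
    by (intro has_bochner_integral_add has_bochner_integral_diff has_bochner_integral_gf_fps)
  have "?g x = 0" if "x \<in> measure_supp M" for x
  proof -
    have X: "fps_X * fps_deriv (gf_fps l P x) = ?\<psi>' x"
    proof (rule fps_ext)
      show "fps_nth (fps_X * fps_deriv (gf_fps l P x)) m = fps_nth (?\<psi>' x) m" for m
        by (cases m) (simp_all add: gf_fps_def)
    qed
    have "gf_fps l P x = ?\<psi> x" by (simp add: gf_fps_def)
    with ode[OF that] X have "?\<psi>' x * (h - fps_const (of_real x) * fps_X)
        + (W * (h - fps_const (of_real x) * fps_X) + N) * ?\<psi> x = 0" by simp
    then have "h * ?\<psi>' x + (W * h + N) * ?\<psi> x - fps_const (of_real x) * (fps_X * ?\<psi>' x)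
        - fps_const (of_real x) * (fps_X * W * ?\<psi> x) = 0"
      by (simp add: algebra_simps)
    from arg_cong[OF this, of "\<lambda>F. fps_nth F n"]
    have nth: "fps_nth (h * ?\<psi>' x) n + fps_nth ((W * h + N) * ?\<psi> x) n
        - of_real x * fps_nth (fps_X * ?\<psi>' x) n - of_real x * fps_nth (fps_X * W * ?\<psi> x) n = 0"
      by (simp only: fps_add_nth fps_sub_nth fps_mult_left_const_nth fps_zero_nth)
    have "complex_of_real (x ^ i) * p + complex_of_real (x ^ i) * q - complex_of_real (x ^ Suc i) * r
        - complex_of_real (x ^ Suc i) * s = complex_of_real (x ^ i) * (p + q - of_real x * r - of_real x * s)"
      for p q r s by (simp add: algebra_simps)
    then show ?thesis by (simp only: nth mult_zero_right)
  qed
  then have "AE x in M. ?g x = 0" using AE_measure_supp[OF sets_borel] by auto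
  then have "integral\<^sup>L M ?g = 0" by (rule integral_eq_zero_AE)
  then show "fps_nth (h * J' i + (W * h + N) * J i - fps_X * J' (Suc i) - fps_X * W * J (Suc i)) n = fps_nth 0 n"
    using has_bochner_integral_integral_eq[OF hb] by simp
qed

lemma ultraspherical_gf_imp_ultra_poly:
  fixes l :: real and E :: "complex poly"
  assumes l: "l > 0" "l \<noteq> 1"
    and M: "standard_measure M" "symmetric_measure M" "infinite (measure_supp M)"
    and P: "monic_orthogonal M P" and J: "jacobi_szego P \<alpha> \<omega>"
    and gf: "ultraspherical_gf M P l S u f"
    and E: "\<And>z. z \<in> S \<Longrightarrow>
       f z - (complex_of_real ((l + 1) * \<omega> 2) * z + complex_of_real (\<alpha> 1)) / 2 = poly E z / z"
  shows "P = ultra_poly ((1 + l) / 2) l \<or> l > 1/2 \<and> P = ultra_poly (l / 2) (l - 1)"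
proof -
  interpret real_moment_measure M
    using M(1) by unfold_locales (auto simp: standard_measure_def)
  \<comment> \<open>Since \<alpha> 1 = 0, the subtracted linear term is b z; adding b z^2 to E gives
    z f z = H.\<close>
  define b where "b = (l + 1) * \<omega> 2 / 2"
  define H where "H = E + monom (of_real b) 2"
  have S0: "0 \<notin> S" "0 \<in> closure S" using gf by (auto simp: ultraspherical_gf_def)
  have f: "f z = poly H z / z" if "z \<in> S" for z
  proof -
    have "z \<noteq> 0" using that S0 by auto
    then show ?thesis using E[OF that] symmetric_jacobi_szego[OF M P J, of 1]
      by (simp add: H_def b_def poly_monom field_simps power2_eq_square)
  qed
  have H0: "poly H 0 = 1"
  proof (rule tendsto_unique)
    show "at 0 within S \<noteq> bot" using S0 by (simp add: closure_def trivial_limit_within)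
    show "(poly H \<longlongrightarrow> poly H 0) (at 0 within S)"
      by (intro tendsto_intros tendsto_poly)
    have "((\<lambda>z. z * f z) \<longlongrightarrow> 1) (at 0 within S)" using gf by (simp add: ultraspherical_gf_def)
    then show "(poly H \<longlongrightarrow> 1) (at 0 within S)"
      by (rule Lim_transform_eventually) (auto simp: eventually_at_filter f S0)
  qed
  have P0: "P 0 = 1"
  proof -
    have "degree (P 0) = 0" "lead_coeff (P 0) = 1" using P unfolding monic_orthogonal_def by blast+
    then show ?thesis by (metis degree_eq_zeroE lead_coeff_pCons(2) one_pCons)
  qed
  have "measure_supp M \<noteq> {}" using M(3) by auto
  define h where "h = fps_of_poly H"
  define c where "c = fps_const (complex_of_real l)"
  define \<kappa> where "\<kappa> = fps_const (complex_of_real (l * b))"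
  define N where "N = c * (fps_X * fps_deriv h - h)"
  obtain W where W: "\<And>x. x \<in> measure_supp M \<Longrightarrow>
      fps_X * fps_deriv (gf_fps l P x) * (h - fps_const (complex_of_real x) * fps_X)
     + (W * (h - fps_const (of_real x) * fps_X) + N) * gf_fps l P x = 0"
    using gf_fps_linear_ode[OF gf f H0 \<open>measure_supp M \<noteq> {}\<close> P0] unfolding h_def N_def c_def by blast
  note mom = symmetric_low_moments[OF M P J]
  have u1: "ultra_coeff l (Suc 0) = l" using ultra_coeff_Suc[of 0 l] by simp
  have "ultra_coeff l 2 = l * (l + 1) / 2" using ultra_coeff_Suc[of 1 l] u1 by (simp add: numeral_2_eq_2 mult.commute)
  then have u2: "ultra_coeff l 2 * \<omega> 2 = l * b" by (simp add: b_def)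
  let ?J = "\<lambda>i. Abs_fps (\<lambda>n. complex_of_real (ultra_coeff l n * (\<integral>x. x ^ i * poly (P n) x \<partial>M)))"
  let ?J' = "\<lambda>i. Abs_fps (\<lambda>n. complex_of_real (real n * ultra_coeff l n * (\<integral>x. x ^ i * poly (P n) x \<partial>M)))"
  \<comment> \<open>By orthogonality the moment series are polynomials: 1, l z and 1 + l b z^2 for i
    = 0, 1, 2. The primed series are their images under z d/dz.\<close>
  have J0: "?J 0 = 1" "?J' 0 = 0"
    unfolding mom(2) by (rule fps_ext; simp)+
  have J1: "?J (Suc 0) = c * fps_X" "?J' (Suc 0) = c * fps_X"
    unfolding mom(3)[unfolded One_nat_def] c_def
    by (rule fps_ext, rename_tac n, case_tac "n = Suc 0", simp_all add: u1)+
  have u2': "complex_of_real (ultra_coeff l (Suc (Suc 0))) * complex_of_real (\<omega> (Suc (Suc 0))) =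
      of_real l * of_real b"
    using u2 by (simp add: numeral_2_eq_2 flip: of_real_mult)
  have \<kappa>2: "2 * \<kappa> = fps_const (of_real (2 * (l * b)))"
    by (simp add: \<kappa>_def numeral_fps_const)
  have J2: "?J (Suc (Suc 0)) = 1 + \<kappa> * fps_X\<^sup>2" "?J' (Suc (Suc 0)) = 2 * \<kappa> * fps_X\<^sup>2"
    unfolding mom(4)[unfolded numeral_2_eq_2] \<kappa>2 unfolding \<kappa>_def numeral_2_eq_2
    by (rule fps_ext, rename_tac n, case_tac "n = Suc (Suc 0)", simp_all add: fps_X_power_iff u2')+
  note eq = gf_fps_moment_equation[OF real_moment_measure_axioms W]
  \<comment> \<open>The linear equation integrated against 1; the next equation is the one
    integrated against x, from which a common factor z is then cancelled.\<close>
  have U: "W * h + N = c * fps_X\<^sup>2 * (1 + W)"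
    using eq[of 0] unfolding J0 J1 by (simp add: algebra_simps power2_eq_square)
  have "fps_X * (c * h + c * (W * h + N) - 2 * \<kappa> * fps_X\<^sup>2 - W * (1 + \<kappa> * fps_X\<^sup>2)) = 0"
    using eq[of "Suc 0"] unfolding J1 J2 by (simp add: algebra_simps power2_eq_square)
  then have e2: "c * h + c * (W * h + N) - 2 * \<kappa> * fps_X\<^sup>2 - W * (1 + \<kappa> * fps_X\<^sup>2) = 0"
    by simp
  have E1: "W * (h - c * fps_X\<^sup>2) = c * (fps_X\<^sup>2 + h - fps_X * fps_deriv h)"
    using U unfolding N_def by (simp add: algebra_simps)
  have E2: "W * (1 + (\<kappa> - c * c) * fps_X\<^sup>2) = c * h + (c * c - 2 * \<kappa>) * fps_X\<^sup>2"
    using e2 unfolding U by (simp add: algebra_simps)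
  have \<kappa>: "\<kappa> = c * fps_const (of_real b)" by (simp add: \<kappa>_def c_def)
  have "c \<noteq> 0" using l by (simp add: c_def)
  \<comment> \<open>\<open>E1\<close> and \<open>E2\<close> each express W times a known series.
    Multiplying \<open>E2\<close> by the factor from \<open>E1\<close> eliminates W and leaves the
    Riccati equation after cancelling c.\<close>
  have "c * ((h + (c - 2 * fps_const (of_real b)) * fps_X\<^sup>2) * (h - c * fps_X\<^sup>2)) =
      (W * (1 + (\<kappa> - c * c) * fps_X\<^sup>2)) * (h - c * fps_X\<^sup>2)"
    unfolding E2 unfolding \<kappa> by (simp add: algebra_simps)
  also have "\<dots> = (W * (h - c * fps_X\<^sup>2)) * (1 + (\<kappa> - c * c) * fps_X\<^sup>2)"
    by (simp only: mult_ac)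
  also have "\<dots> = c * ((fps_X\<^sup>2 + h - fps_X * fps_deriv h) * (1 + c * (fps_const (of_real b) - c) * fps_X\<^sup>2))"
    unfolding E1 unfolding \<kappa> by (simp add: algebra_simps)
  finally have ric: "(h + (c - 2 * fps_const (of_real b)) * fps_X\<^sup>2) * (h - c * fps_X\<^sup>2) =
      (fps_X\<^sup>2 + h - fps_X * fps_deriv h) * (1 + c * (fps_const (of_real b) - c) * fps_X\<^sup>2)"
    using \<open>c \<noteq> 0\<close> by simp
  have cc: "c - 2 * fps_const (of_real b) = fps_const (of_real (l - 2 * b))"
    "c * (fps_const (of_real b) - c) = fps_const (of_real (l * (b - l)))"
    by (simp_all add: c_def numeral_fps_const)
  have "fps_of_poly ((H + smult (of_real (l - 2 * b)) (monom 1 2)) * (H - smult (of_real l) (monom 1 2))) =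
      fps_of_poly ((monom 1 2 + H - [:0, 1:] * pderiv H) * (1 + smult (of_real (l * (b - l))) (monom 1 2)))"
    using ric unfolding cc unfolding h_def c_def
    by (simp only: fps_of_poly_mult fps_of_poly_add fps_of_poly_diff fps_of_poly_smult fps_of_poly_monom'
        fps_of_poly_pderiv fps_of_poly_pCons fps_of_poly_1 fps_of_poly_0 fps_const_0_eq_0 fps_const_1_eq_1 add_0 mult_zero_left mult_1_left add_0_right)
  then have req: "(H + smult (of_real (l - 2 * b)) (monom 1 2)) * (H - smult (of_real l) (monom 1 2)) =
      (monom 1 2 + H - [:0, 1:] * pderiv H) * (1 + smult (of_real (l * (b - l))) (monom 1 2))"
    by (simp only: fps_of_poly_eq_iff)
  \<comment> \<open>The common end of both cases: the two generating functions solve the same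
    first-order equation at each point of the infinite support, so their coefficients agree there
    and are equal as polynomials.\<close>
  have conclude: "P = Q"
    if H: "h = 1 + fps_const (of_real a) * fps_X ^ 2" and V: "W * V = c * V - fps_X * fps_deriv V" "fps_nth V 0 = 1"
      and Q: "\<And>x. gf_fps l Q x = V * gf_fps l (ultra_poly a l) x" for a V Q
  proof -
    have eq: "gf_fps l P x = gf_fps l Q x" if x: "x \<in> measure_supp M" for x
    proof (rule fps_first_order_ode_unique)
      let ?G = "h - fps_const (complex_of_real x) * fps_X"
      show "fps_X * ?G * fps_deriv (gf_fps l P x) = - (W * ?G + N) * gf_fps l P x"
        using W[OF x] by (simp add: algebra_simps add_eq_0_iff2)
      have "fps_X * fps_deriv (gf_fps l Q x) * ?G + (W * ?G + N) * gf_fps l Q x = 0"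
        unfolding Q N_def
      proof (rule gf_equation_of_factor)
        show "?G * fps_deriv (gf_fps l (ultra_poly a l) x) =
            c * (fps_const (complex_of_real x) - fps_deriv h) * gf_fps l (ultra_poly a l) x"
          using gf_fps_ultra_poly_ode[OF l(1), of a x] by (simp only: H c_def)
      qed (use V in auto)
      then show "fps_X * ?G * fps_deriv (gf_fps l Q x) = - (W * ?G + N) * gf_fps l Q x"
        by (simp add: algebra_simps add_eq_0_iff2)
      have "fps_nth ?G 0 = 1" by (simp add: H)
      then have "?G \<noteq> 0" by (metis fps_zero_nth zero_neq_one)
      then show "fps_X * ?G \<noteq> 0" by simp
      show "fps_nth (gf_fps l P x) 0 = 1" by (simp add: gf_fps_def P0)
      show "fps_nth (gf_fps l Q x) 0 = 1" unfolding Q by (simp add: V gf_fps_def)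
    qed
    show "P = Q"
    proof
      fix n
      have uc: "ultra_coeff l n \<noteq> 0" using l(1) pochhammer_pos[of l n] by (simp add: ultra_coeff_def)
      have "measure_supp M \<subseteq> {x. poly (P n - Q n) x = 0}"
        using arg_cong[OF eq, of _ "\<lambda>F. fps_nth F n"] uc by (auto simp: gf_fps_def)
      then have "infinite {x. poly (P n - Q n) x = 0}" using M(3) finite_subset by blast
      then show "P n = Q n" using poly_roots_finite[of "P n - Q n"] by auto
    qed
  qed
  have hH: "h = 1 + fps_const (of_real a) * fps_X ^ 2" if "H = [:1, 0, of_real a:]" for a :: real
    unfolding h_def that by (simp add: fps_of_poly_pCons power2_eq_square mult.assoc)
  have h': "fps_X * fps_deriv h = 2 * fps_const (of_real a) * fps_X\<^sup>2" if "h = 1 + fps_const (of_real a) * fps_X ^ 2" for a :: real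
    unfolding that by (simp add: power2_eq_square algebra_simps)
  have E1': "W * (1 + fps_const (of_real (a - l)) * fps_X\<^sup>2) = c * (1 + fps_const (of_real (1 - a)) * fps_X\<^sup>2)"
    if "h = 1 + fps_const (of_real a) * fps_X ^ 2" for a :: real
  proof -
    have k: "fps_const (of_real (a - l)) = fps_const (of_real a) - c" "fps_const (of_real (1 - a)) = 1 - fps_const (complex_of_real a)"
      by (simp_all add: c_def flip: fps_const_1_eq_1)
    show ?thesis using E1 unfolding k h'[OF that] unfolding that by (simp add: algebra_simps)
  qed
  consider "H = [:1, 0, of_real ((1 + l) / 2):]" | "b = l - 1/2" "H = [:1, 0, of_real (l / 2):]"
    using riccati_polynomial_solution[OF l _ req] H0 by (auto simp: poly_0_coeff_0)
  then show ?thesis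
  proof cases
    case 1
    note h = hH[OF 1]
    \<comment> \<open>For a = (1 + l) / 2 the numbers a - l and 1 - a coincide, so W is the constant
      l and V = 1.\<close>
    have "(W - c) * (1 + fps_const (of_real ((1 - l) / 2)) * fps_X\<^sup>2) = 0"
    proof -
      have "(1 + l) / 2 - l = (1 - l) / 2" "1 - (1 + l) / 2 = (1 - l) / 2" by (simp_all add: field_simps)
      then show ?thesis using E1'[OF h] by (simp only: left_diff_distrib right_minus_eq)
    qed
    moreover have "1 + fps_const (complex_of_real ((1 - l) / 2)) * fps_X\<^sup>2 \<noteq> 0"
    proof
      assume "1 + fps_const (complex_of_real ((1 - l) / 2)) * fps_X\<^sup>2 = 0"
      from arg_cong[OF this, of "\<lambda>F. fps_nth F 0"] show False by simp
    qed
    ultimately have "W = c" by simp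
    then have "P = ultra_poly ((1 + l) / 2) l"
      by (intro conclude[OF h, of 1]) simp_all
    then show ?thesis ..
  next
    case 2
    note h = hH[OF 2(2)]
    define V where "V = 1 - fps_const (complex_of_real (l / 2)) * fps_X\<^sup>2"
    have "b > 0" using mom(1) l by (simp add: b_def)
    \<comment> \<open>The restriction l > 1/2 comes from positivity of \<open>\<omega> 2\<close>, as
      b = l - 1/2 must be positive.\<close>
    then have l2: "l > 1/2" using 2 by simp
    have WV: "W * V = c * V - fps_X * fps_deriv V"
    proof -
      define a where "a = fps_const (complex_of_real (l / 2))"
      have c: "c = 2 * a" by (simp add: c_def a_def numeral_fps_const)
      have "fps_const (of_real (l / 2 - l)) = - a" "fps_const (of_real (1 - l / 2)) = 1 - a"
        by (simp_all add: a_def flip: fps_const_1_eq_1)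
      then have "W * (1 - a * fps_X\<^sup>2) = c * (1 + (1 - a) * fps_X\<^sup>2)"
        using E1'[OF h] by simp
      moreover have "fps_X * fps_deriv V = - (2 * a * fps_X\<^sup>2)"
        by (simp add: V_def a_def power2_eq_square algebra_simps)
      ultimately show ?thesis unfolding V_def a_def[symmetric] by (simp add: c algebra_simps)
    qed
    have "P = ultra_poly (l / 2) (l - 1)"
    proof (rule conclude[OF h WV])
      show "gf_fps l (ultra_poly (l / 2) (l - 1)) x = V * gf_fps l (ultra_poly (l / 2) l) x" for x
        using gf_fps_ultra_poly_shift_parameter[OF l2 l(2)] by (simp add: V_def)
    qed (simp add: V_def)
    with l2 show ?thesis by blast
  qed
qed

section \<open>The characterization\<close>

text \<open>The last two conjuncts state the density form of each polynomial alternative. The second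
  is stated for l > 1/2, where the parameter l - 1 exceeds -1/2 and the weight is
  integrable.\<close>

theorem mainTheorem3:
  fixes l :: real and M :: "real measure" and P :: "nat \<Rightarrow> real poly"
    and \<alpha> \<omega> :: "nat \<Rightarrow> real"
  assumes "l > 0" and "l \<noteq> 1"
    and "standard_measure M" and "symmetric_measure M" and "infinite (measure_supp M)"
    and "monic_orthogonal M P" and "jacobi_szego P \<alpha> \<omega>"
  shows
    "((\<exists>S u f. ultraspherical_gf M P l S u f \<and> interchange_condition M P l S \<and>
        (\<exists>E::complex poly. \<forall>z\<in>S.
           f z - (complex_of_real ((l + 1) * \<omega> 2) * z + complex_of_real (\<alpha> 1)) / 2 = poly E z / z))
      \<longleftrightarrow>
      ((\<forall>n x. poly (P n) x =
          sqrt (2 * (1 + l)) ^ n * poly (gegenbauer l n) (x / sqrt (2 * (1 + l))))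
       \<or>
       (l > 1/2 \<and>
        (\<forall>n x. poly (P n) x =
          sqrt (2 * l) ^ n * poly (gegenbauer (l - 1) n) (x / sqrt (2 * l))))))
     \<and>
     ((\<forall>n x. poly (P n) x =
          sqrt (2 * (1 + l)) ^ n * poly (gegenbauer l n) (x / sqrt (2 * (1 + l))))
      \<longleftrightarrow>
      (\<exists>c>0. M = density lborel (\<lambda>x. ennreal (c * (1 - x\<^sup>2 / (2 * (1 + l))) powr (l - 1/2)
          * indicator {- sqrt (2 * (1 + l))..sqrt (2 * (1 + l))} x))))
     \<and>
     (l > 1/2 \<longrightarrow>
      ((\<forall>n x. poly (P n) x =
          sqrt (2 * l) ^ n * poly (gegenbauer (l - 1) n) (x / sqrt (2 * l)))
       \<longleftrightarrow>
       (\<exists>c>0. M = density lborel (\<lambda>x. ennreal (c * (1 - x\<^sup>2 / (2 * l)) powr (l - 3/2)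
          * indicator {- sqrt (2 * l)..sqrt (2 * l)} x)))))"
proof -
  note l = assms(1,2) and M = assms(3-5) and P = assms(6) and J = assms(7)
  interpret M: real_moment_measure M
    using M(1) by unfold_locales (auto simp: standard_measure_def)
  have ps: "prob_space M" using M(1) by (simp add: standard_measure_def)
  define A where "A \<longleftrightarrow> (\<exists>S u f. ultraspherical_gf M P l S u f \<and> interchange_condition M P l S \<and>
        (\<exists>E::complex poly. \<forall>z\<in>S.
           f z - (complex_of_real ((l + 1) * \<omega> 2) * z + complex_of_real (\<alpha> 1)) / 2 = poly E z / z))"
  have r: "2 * (1 + l) / 4 = (1 + l) / 2" "2 * l / 4 = l / 2" by simp_all
  have geg1: "(\<forall>n x. poly (P n) x =
          sqrt (2 * (1 + l)) ^ n * poly (gegenbauer l n) (x / sqrt (2 * (1 + l)))) \<longleftrightarrow>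
      P = ultra_poly ((1 + l) / 2) l"
    by (rule scaled_gegenbauer_iff[of l "2 * (1 + l)" P, unfolded r]) (use l in auto)
  have geg2: "(\<forall>n x. poly (P n) x =
          sqrt (2 * l) ^ n * poly (gegenbauer (l - 1) n) (x / sqrt (2 * l))) \<longleftrightarrow>
      P = ultra_poly (l / 2) (l - 1)" if "l > 1/2"
    by (rule scaled_gegenbauer_iff[of "l - 1" "2 * l" P, unfolded r]) (use l that in auto)
  have dens1: "P = ultra_poly ((1 + l) / 2) l \<longleftrightarrow> (\<exists>c>0. M = ultra_measure c (2 * (1 + l)) l)"
    by (rule ultra_poly_iff_ultra_measure[of l "2 * (1 + l)" M P, unfolded r]) (use l M P in auto)
  have dens2: "P = ultra_poly (l / 2) (l - 1) \<longleftrightarrow> (\<exists>c>0. M = ultra_measure c (2 * l) (l - 1))" if "l > 1/2"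
    by (rule ultra_poly_iff_ultra_measure[of "l - 1" "2 * l" M P, unfolded r]) (use l M P that in auto)
  have construct: A
    if c: "M = ultra_measure c r \<nu>'" and r: "r > 0" and P_eq: "P = ultra_poly (r / 4) \<nu>"
      and V: "\<And>x. gf_fps l (ultra_poly (r / 4) \<nu>) x = fps_of_poly V * gf_fps l (ultra_poly (r / 4) l) x"
        "poly V 0 = 1" for c r \<nu> \<nu>' V
  proof -
    obtain S u f where Suf: "ultraspherical_gf M P l S u f" "interchange_condition M P l S"
        "\<And>z. z \<in> S \<Longrightarrow> f z = 1 / z + of_real (r / 4) * z"
      using exists_ultraspherical_gf[OF l(1) _ M.real_moment_measure_axioms ps _ _ V, of "sqrt r"]
        measure_supp_ultra_measure_subset[of c r \<nu>'] AE_ultra_measure[where c = c and r = r and \<nu> = \<nu>'] r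
      unfolding c[symmetric] P_eq by auto
    \<comment> \<open>From z f z = 1 + (r / 4) z^2 the prescribed linear term, multiplied by z, is
      subtracted.\<close>
    let ?E = "[:1, 0, complex_of_real (r / 4 - (l + 1) * \<omega> 2 / 2):]"
    have "f z - (complex_of_real ((l + 1) * \<omega> 2) * z + complex_of_real (\<alpha> 1)) / 2 = poly ?E z / z"
      if "z \<in> S" for z
    proof -
      have "z \<noteq> 0" using Suf(1) that by (auto simp: ultraspherical_gf_def)
      then show ?thesis using symmetric_jacobi_szego[OF M P J, of 1]
        by (simp add: Suf(3)[OF that] field_simps)
    qed
    with Suf show ?thesis unfolding A_def by blast
  qed
  have "A \<longleftrightarrow> P = ultra_poly ((1 + l) / 2) l \<or> l > 1/2 \<and> P = ultra_poly (l / 2) (l - 1)"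
  proof
    assume A
    then show "P = ultra_poly ((1 + l) / 2) l \<or> l > 1/2 \<and> P = ultra_poly (l / 2) (l - 1)"
      unfolding A_def using ultraspherical_gf_imp_ultra_poly[OF l M P J] by blast
  next
    assume "P = ultra_poly ((1 + l) / 2) l \<or> l > 1/2 \<and> P = ultra_poly (l / 2) (l - 1)"
    then show A
    proof (elim disjE conjE)
      assume eq: "P = ultra_poly ((1 + l) / 2) l"
      then obtain c where "M = ultra_measure c (2 * (1 + l)) l" using dens1 by blast
      then show A
        by (rule construct[of _ "2 * (1 + l)" l l 1, unfolded r]) (use l eq in auto)
    next
      assume l2: "l > 1/2" and eq: "P = ultra_poly (l / 2) (l - 1)"
      then obtain c where c: "M = ultra_measure c (2 * l) (l - 1)" using dens2 by blast
      have "fps_of_poly [:1, 0, - complex_of_real (l / 2):] = 1 - fps_const (complex_of_real (l / 2)) * fps_X ^ 2"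
        by (simp add: fps_of_poly_pCons power2_eq_square mult.assoc flip: fps_const_neg)
      with c show A
        using gf_fps_ultra_poly_shift_parameter[OF l2 l(2), of "l / 2"]
        by (intro construct[of _ "2 * l" "l - 1" "l - 1" "[:1, 0, - complex_of_real (l / 2):]", unfolded r]) (use l eq in \<open>auto simp: poly_monom\<close>)
    qed
  qed
  moreover have "ultra_measure c (2 * (1 + l)) l = density lborel (\<lambda>x. ennreal (c * (1 - x\<^sup>2 / (2 * (1 + l))) powr (l - 1/2)
          * indicator {- sqrt (2 * (1 + l))..sqrt (2 * (1 + l))} x))" for c
    by (simp add: ultra_measure_def ultra_weight_def)
  moreover have "ultra_measure c (2 * l) (l - 1) = density lborel (\<lambda>x. ennreal (c * (1 - x\<^sup>2 / (2 * l)) powr (l - 3/2)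
          * indicator {- sqrt (2 * l)..sqrt (2 * l)} x))" for c
    by (simp add: ultra_measure_def ultra_weight_def)
  ultimately show ?thesis
    using geg1 geg2 dens1 dens2 unfolding A_def by auto
qed

end
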